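(* Let $r,k,n$ be integers with $r\ge 3$, $k\ge 3r+4$ and $n\ge 108(r+1)^r k$. Let $G$ be an $n$-vertex graph containing no cycle $C_{2k+1}$ of length $2k+1$ as a subgraph. If $\delta(G)\ge \frac{n}{2r+2}$, then $G$ is $r$-partite, or $G$ is (isomorphic to) $G_{r+1}$.
   Context: $\delta(G)$ denotes the minimum degree of $G$. $G_{r+1}$ denotes the $n$-vertex graph obtained by taking $r+1$ vertex-disjoint copies of the complete bipartite graph $K_{\frac{n}{2(r+1)},\frac{n}{2(r+1)}}$ and selecting one vertex in each copy such that these $r+1$ selected vertices form a complete graph $K_{r+1}$ (i.e., adding all edges between the selected vertices). *)

theory Defs
  imports
    Complex_Main
    "HOL-Library.Disjoint_Sets"
    "Graph_Theory.Graph_Theory"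
begin

text \<open>
  A finite simple graph is a \<^locale>\<open>pair_graph\<close>: a finite, loop-free, symmetric digraph whose
  arcs are ordered pairs of vertices, so an undirected edge is a pair of opposite arcs and the
  degree of a vertex is its \<^const>\<open>out_degree\<close>.  For lengths of at least three the undirected cycles
  are exactly the directed cycles (\<^const>\<open>pre_digraph.cycle\<close>) of the symmetric digraph.
\<close>

(* Min is unspecified on the empty set, so this is only meaningful for nonempty finite graphs. *)
definition min_degree :: "('a, 'b) pre_digraph \<Rightarrow> nat" where
  "min_degree G = Min (out_degree G ` verts G)"

(* Parts may be empty, so r-partite is the same as r-colourable. *)
definition partite :: "nat \<Rightarrow> ('a, 'b) pre_digraph \<Rightarrow> bool" where
  "partite r G \<longleftrightarrow> (\<exists>V :: nat \<Rightarrow> 'a set.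
     verts G = (\<Union>i<r. V i) \<and> disjoint_family_on V {..<r} \<and>
     (\<forall>i<r. \<forall>u\<in>V i. \<forall>v\<in>V i. (u, v) \<notin> arcs_ends G))"

text \<open>
  The vertex \<open>(i, b, j)\<close> is the \<open>j\<close>-th vertex on side \<open>b\<close> of the \<open>i\<close>-th copy of the
  complete bipartite graph \<open>K\<^bsub>m,m\<^esub>\<close>, and \<open>(i, False, 0)\<close> is the vertex selected in copy \<open>i\<close>.
  Thus \<open>G\<^bsub>r+1\<^esub>\<close> on \<open>n\<close> vertices is the case \<open>s = r + 1\<close> and \<open>m = n / (2 * (r + 1))\<close>;
  it exists only if \<open>2 * (r + 1)\<close> divides \<open>n\<close>.
\<close>
definition bipartite_copies_clique :: "nat \<Rightarrow> nat \<Rightarrow> (nat \<times> bool \<times> nat) pair_pre_digraph" where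
  "bipartite_copies_clique s m = \<lparr>
     pverts = {..<s} \<times> UNIV \<times> {..<m},
     parcs = {((i, b, j), (i', b', j')). i < s \<and> i' < s \<and> j < m \<and> j' < m \<and>
                (i = i' \<and> b \<noteq> b' \<or> i \<noteq> i' \<and> \<not> b \<and> \<not> b' \<and> j = 0 \<and> j' = 0)} \<rparr>"

lemma pair_graph_bipartite_copies_clique: "pair_graph (bipartite_copies_clique s m)"
proof
  show "finite (parcs (bipartite_copies_clique s m))"
    by (rule finite_subset[of _ "({..<s} \<times> UNIV \<times> {..<m}) \<times> ({..<s} \<times> UNIV \<times> {..<m})"])
      (auto simp: bipartite_copies_clique_def)
qed (auto simp: bipartite_copies_clique_def symmetric_def sym_def)

lemma card_pverts_bipartite_copies_clique: "card (pverts (bipartite_copies_clique s m)) = 2 * s * m"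
  by (simp add: bipartite_copies_clique_def card_cartesian_product)

lemma arcs_ends_induce: "arcs_ends (with_proj G \<restriction> W) = parcs G \<inter> W \<times> W"
  unfolding arcs_ends_conv induce_subgraph_def by (auto simp: image_def)

lemma graph_induce:
  assumes "pair_graph G" "finite W"
  shows "graph (with_proj G \<restriction> W)"
proof -
  interpret pair_graph G by fact
  have "sym (parcs G \<inter> W \<times> W)"
    by (auto simp: sym_def intro: arcs_symmetric)
  moreover have "finite {e \<in> parcs G. fst e \<in> W \<and> snd e \<in> W}"
    using pair_finite_arcs by simp
  ultimately show ?thesis
    using assms(2)
    by unfold_locales
      (simp_all only: symmetric_def arcs_ends_induce,
        simp_all add: arc_to_ends_def induce_subgraph_def pair_no_loops prod_eq_iff)
qed

lemma copy_complete_bipartite: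
  assumes "i < s"
  shows "K\<^bsub>m,m\<^esub> (with_proj (bipartite_copies_clique s m) \<restriction> ({i} \<times> UNIV \<times> {..<m}))"
proof -
  let ?U = "\<lambda>b :: bool. {i} \<times> {b} \<times> {..<m}"
  let ?H = "with_proj (bipartite_copies_clique s m) \<restriction> ({i} \<times> UNIV \<times> {..<m})"
  have 1: "verts ?H = ?U False \<union> ?U True"
    by (auto simp: induce_subgraph_def)
  have 2: "arcs_ends ?H = ?U False \<times> ?U True \<union> ?U True \<times> ?U False"
    using assms by (auto simp: arcs_ends_induce bipartite_copies_clique_def)
  have 3: "graph ?H"
    by (rule graph_induce[OF pair_graph_bipartite_copies_clique]) simp
  have 4: "card (?U b) = m" for b
    by (simp add: card_cartesian_product)
  have 5: "?U False \<inter> ?U True = {}"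
    by auto
  show ?thesis
    unfolding complete_bipartite_digraph_def using 1 2 3 4 5 by blast
qed

lemma selected_complete:
  assumes "0 < m"
  shows "K\<^bsub>s\<^esub> (with_proj (bipartite_copies_clique s m) \<restriction> ({..<s} \<times> {False} \<times> {0}))"
  unfolding complete_digraph_def
proof (intro conjI)
  show "graph (with_proj (bipartite_copies_clique s m) \<restriction> ({..<s} \<times> {False} \<times> {0}))"
    by (rule graph_induce[OF pair_graph_bipartite_copies_clique]) simp
qed (use assms in \<open>auto simp: arcs_ends_induce card_cartesian_product bipartite_copies_clique_def\<close>)

end

theory Submission
  imports Defs "HOL-Combinatorics.Transposition"
begin

text \<open>
  Call two vertices linked if they have at least \<open>t = 6(r+1)k\<close> common neighbours.  Counting shows
  that among any \<open>2r+3\<close> vertices two are linked, so long paths of linked vertices exist inside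
  every large set, and linked vertices are joined by even paths of every length up to \<open>2k\<close> that
  avoid any few given vertices.  Hence no odd path, of whatever length, joins linked vertices:
  every third vertex of a shortest such path would give a linked pair other than its two ends,
  and a detour through a common neighbour of that pair would shorten the path; so the path is
  short and closes up to a \<open>C\<^bsub>2k+1\<^esub>\<close>.

  Say that a set is parity-connected if it joins any two of its vertices by paths of both parities.
  Such a set contains no linked pair, so it has at most \<open>2r+2\<close> vertices.  A graph that is not
  \<open>r\<close>-colourable contains a maximal parity-connected set \<open>B\<close> that is not \<open>r\<close>-colourable.
  As \<open>B\<close> has no ears, the pieces of the graph hanging off the vertices of \<open>B\<close> are disjoint.  Each
  piece contains two adjacent vertices with disjoint neighbourhoods inside the piece, so it has at
  least \<open>n/(r+1)\<close> vertices.  Thus \<open>B\<close> is a \<open>K\<^bsub>r+1\<^esub>\<close> and all the inequalities are equalities.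
\<close>


section \<open>Pairs of vertices with many common neighbours\<close>

text \<open>A longest \<open>R\<close>-path ends in a vertex with no \<open>R\<close>-neighbour off
  the path. Deleting such a path costs at most \<open>k\<close> vertices unless it is already long
  enough, and its last vertex can be added to an independent set found among the remaining
  vertices.\<close>

lemma long_path_or_independent:
  assumes R: "symp R" and M: "finite M" "s * k < card M"
  shows "(\<exists>p. distinct p \<and> set p \<subseteq> M \<and> successively R p \<and> length p = Suc k) \<or>
    (\<exists>I\<subseteq>M. card I = Suc s \<and> (\<forall>x\<in>I. \<forall>y\<in>I. x \<noteq> y \<longrightarrow> \<not> R x y))"
  using M
proof (induction s arbitrary: M)
  case 0
  then obtain x where "x \<in> M"
    by (metis card_gt_0_iff ex_in_conv mult_0)
  then show ?case
    by (intro disjI2 exI[of _ "{x}"]) auto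
next
  case (Suc s)
  let ?P = "\<lambda>p. p \<noteq> [] \<and> distinct p \<and> set p \<subseteq> M \<and> successively R p"
  show ?case
  proof (rule ccontr)
    assume neg: "\<not> ?case"
    have short: "length p \<le> k" if "?P p" for p
    proof (rule ccontr)
      assume "\<not> length p \<le> k"
      moreover have "successively R (take (Suc k) p)"
        using that successively_append_iff[of R "take (Suc k) p" "drop (Suc k) p"] by simp
      ultimately have "distinct (take (Suc k) p) \<and> set (take (Suc k) p) \<subseteq> M \<and>
          successively R (take (Suc k) p) \<and> length (take (Suc k) p) = Suc k"
        using that by (auto dest: in_set_takeD)
      then show False
        using neg by blast
    qed
    obtain x where "x \<in> M"
      using Suc.prems by (metis card.empty ex_in_conv not_less_zero)
    then have "?P [x]"
      by simp
    then have "\<exists>p. ?P p \<and> (\<forall>q. ?P q \<longrightarrow> length q \<le> length p)"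
      by (rule ex_has_greatest_nat[where b = "Suc k"]) (use short in \<open>auto simp: less_Suc_eq_le\<close>)
    then obtain p where p: "?P p" and longest: "\<And>q. ?P q \<Longrightarrow> length q \<le> length p"
      by metis
    have "card (set p) \<le> k"
      using short[OF p] card_length[of p] by linarith
    moreover have "card (M - set p) = card M - card (set p)"
      using p Suc.prems by (simp add: card_Diff_subset)
    ultimately have "s * k < card (M - set p)"
      using Suc.prems by simp
    then consider q where "distinct q" "set q \<subseteq> M - set p" "successively R q" "length q = Suc k"
      | I where "I \<subseteq> M - set p" "card I = Suc s" "\<forall>x\<in>I. \<forall>y\<in>I. x \<noteq> y \<longrightarrow> \<not> R x y"
      using Suc.IH[of "M - set p"] Suc.prems by blast
    then show False
    proof cases
      case 1
      then show False
        using neg by blast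
    next
      case 2
      have "\<not> R (last p) y" if "y \<in> I" for y
      proof
        assume "R (last p) y"
        with p that 2 have "?P (p @ [y])"
          by (auto simp: successively_append_iff)
        then show False
          using longest[of "p @ [y]"] by simp
      qed
      moreover have "last p \<in> M" "last p \<notin> I"
        using p 2(1) last_in_set[of p] by blast+
      moreover have "finite I"
        using 2 card_ge_0_finite by force
      ultimately have "insert (last p) I \<subseteq> M \<and> card (insert (last p) I) = Suc (Suc s) \<and>
          (\<forall>x\<in>insert (last p) I. \<forall>y\<in>insert (last p) I. x \<noteq> y \<longrightarrow> \<not> R x y)"
        using 2 R by (auto dest: sympD)
      then show False
        using neg by blast
    qed
  qed
qed

section \<open>Graphs as adjacency relations\<close>

locale simple_graph =
  fixes V :: "'a set" and E :: "'a \<Rightarrow> 'a \<Rightarrow> bool"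
  assumes finite_V: "finite V"
    and sym: "E u v \<Longrightarrow> E v u"
    and irrefl: "\<not> E u u"
    and in_V: "E u v \<Longrightarrow> u \<in> V"
begin

definition nbrs :: "'a \<Rightarrow> 'a set" where
  "nbrs u = {v. E u v}"

lemma nbrs_subset: "nbrs u \<subseteq> V"
  using in_V sym by (auto simp: nbrs_def)

lemma finite_nbrs [simp]: "finite (nbrs u)"
  using finite_V nbrs_subset finite_subset by blast

lemma successively_E_rev [simp]: "successively E (rev p) \<longleftrightarrow> successively E p"
proof -
  have "(\<lambda>x y. E y x) = E"
    using sym by blast
  then show ?thesis
    by (simp only: successively_rev)
qed

end

text \<open>In the application \<open>s\<close> is \<open>2 * (r + 1)\<close> and \<open>t\<close>
  is \<open>6 * (r + 1) * k\<close>. The bound \<open>3 * s \<le> 2 * k\<close> lets a path with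
  more than \<open>2 * k\<close> vertices carry \<open>s + 1\<close> vertices spaced three apart,
  and \<open>(s + 4) * k \<le> t\<close> leaves room in common neighbourhoods for greedy
  choices.\<close>

locale odd_cycle_free_graph = simple_graph +
  fixes s k t :: nat
  assumes no_cycle: "distinct p \<Longrightarrow> length p = 2 * k + 1 \<Longrightarrow> successively E p \<Longrightarrow>
      \<not> E (last p) (hd p)"
    and large_codegree: "I \<subseteq> V \<Longrightarrow> card I = Suc s \<Longrightarrow>
      \<exists>x\<in>I. \<exists>y\<in>I. x \<noteq> y \<and> t \<le> card (nbrs x \<inter> nbrs y)"
    and params: "2 \<le> s" "3 * s \<le> 2 * k" "(s + 4) * k \<le> t"
begin

section \<open>Linked vertices and the even paths between them\<close>

definition linked :: "'a \<Rightarrow> 'a \<Rightarrow> bool" where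
  "linked x y \<longleftrightarrow> x \<noteq> y \<and> t \<le> card (nbrs x \<inter> nbrs y)"

lemma linked_sym: "linked x y \<Longrightarrow> linked y x"
  by (auto simp: linked_def Int_commute)

lemma t_large: "4 * k + 2 \<le> t" "s * k + 2 * k < t"
proof -
  have "2 * k \<le> s * k"
    using params by simp
  moreover have "(s + 4) * k = s * k + 4 * k"
    by algebra
  ultimately show "4 * k + 2 \<le> t" "s * k + 2 * k < t"
    using params by linarith+
qed

text \<open>Common neighbours are inserted greedily between consecutive vertices, working from the
  back. Forbidding \<open>y\<close> in the recursive call keeps it off the tail; this raises
  \<open>card F\<close> by at most one while \<open>2 * length ys\<close> drops by two, so the bound
  survives.\<close>

lemma interleave:
  assumes "ys \<noteq> []" "distinct ys" "successively linked ys" "finite F"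
    "card F + 2 * length ys \<le> t"
  shows "\<exists>q. q \<noteq> [] \<and> hd q = hd ys \<and> last q = last ys \<and> distinct q \<and> length q = 2 * length ys - 1 \<and>
    successively E q \<and> set ys \<subseteq> set q \<and> (set q - set ys) \<inter> F = {}"
  using assms
proof (induction ys arbitrary: F)
  case (Cons y ys)
  show ?case
  proof (cases "ys = []")
    case True
    then show ?thesis
      by (intro exI[of _ "[y]"]) auto
  next
    case False
    have "card (insert y F) \<le> Suc (card F)"
      by (rule card_insert_le_m1) auto
    then obtain q where q: "q \<noteq> []" "hd q = hd ys" "last q = last ys" "distinct q"
        "length q = 2 * length ys - 1" "successively E q" "set ys \<subseteq> set q"
        "(set q - set ys) \<inter> insert y F = {}"
      using Cons.IH[of "insert y F"] Cons.prems False by (auto simp: successively_Cons)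
    have "card (F \<union> set q) \<le> card F + card (set q)"
      by (rule card_Un_le)
    also have "\<dots> < t"
      using q Cons.prems False by (cases ys) (simp_all add: distinct_card)
    also have "t \<le> card (nbrs y \<inter> nbrs (hd ys))"
      using Cons.prems False by (auto simp: successively_Cons linked_def)
    finally have "\<not> nbrs y \<inter> nbrs (hd ys) \<subseteq> F \<union> set q"
      using card_mono[of "F \<union> set q" "nbrs y \<inter> nbrs (hd ys)"] Cons.prems by auto
    then obtain z where z: "E y z" "E (hd ys) z" "z \<notin> F" "z \<notin> set q"
      by (auto simp: nbrs_def)
    then have "z \<noteq> y" "E z (hd q)"
      using irrefl sym q by auto
    moreover have "y \<notin> set q"
      using q Cons.prems by auto
    ultimately show ?thesis
      using q z False
      by (intro exI[of _ "y # z # q"]) (auto simp: successively_Cons Suc_diff_le)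
  qed
qed simp

text \<open>Inside the common neighbourhood of \<open>a\<close> and \<open>b\<close>, where
  \<open>s + 1\<close> pairwise unlinked vertices cannot occur, there is a path of
  \<open>j + 1\<close> linked vertices. Interleaving keeps its two ends, which are adjacent to both
  \<open>a\<close> and \<open>b\<close>.\<close>

lemma even_path_between_linked:
  assumes "linked a b" "finite S" "card S \<le> 2 * k" "j < k"
  shows "\<exists>q. distinct q \<and> length q = 2 * j + 1 \<and> successively E (a # q @ [b]) \<and> set q \<inter> S = {}"
proof -
  let ?M = "(nbrs a \<inter> nbrs b) - S"
  have "s * j \<le> s * k"
    using assms by simp
  moreover have "card (nbrs a \<inter> nbrs b) - card S \<le> card ?M"
    by (rule diff_card_le_card_Diff) (rule assms)
  moreover have "t \<le> card (nbrs a \<inter> nbrs b)"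
    using assms by (simp add: linked_def)
  ultimately have "s * j < card ?M"
    using t_large assms by linarith
  moreover have "symp linked"
    using linked_sym by (auto intro: sympI)
  moreover have "\<not> (\<exists>I\<subseteq>?M. card I = Suc s \<and> (\<forall>x\<in>I. \<forall>y\<in>I. x \<noteq> y \<longrightarrow> \<not> linked x y))"
    using large_codegree nbrs_subset unfolding linked_def by (meson Diff_subset inf.coboundedI1 order_trans)
  ultimately obtain ys where ys: "distinct ys" "set ys \<subseteq> ?M" "successively linked ys" "length ys = Suc j"
    using long_path_or_independent[of linked ?M s j] by auto
  have "card S + 2 * length ys \<le> t"
    using assms ys t_large by linarith
  moreover have "ys \<noteq> []"
    using ys by auto
  ultimately obtain q where q: "q \<noteq> []" "hd q = hd ys" "last q = last ys" "distinct q"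
      "length q = 2 * length ys - 1" "successively E q" "(set q - set ys) \<inter> S = {}"
    using interleave[of ys S] ys assms by blast
  have "hd ys \<in> ?M" "last ys \<in> ?M"
    using ys(2) hd_in_set[OF \<open>ys \<noteq> []\<close>] last_in_set[OF \<open>ys \<noteq> []\<close>] by blast+
  then have "E a (hd q)" "E (last q) b"
    using q sym by (auto simp: nbrs_def)
  then show ?thesis
    using q ys by (intro exI[of _ q]) (auto simp: successively_Cons successively_append_iff)
qed

section \<open>Excluding odd paths between linked vertices\<close>

lemma common_neighbour:
  assumes "linked x y"
  obtains z where "E x z" "E y z" "z \<noteq> x" "z \<noteq> y"
proof -
  have "nbrs x \<inter> nbrs y \<noteq> {}"
    using assms t_large by (auto simp: linked_def)
  then show ?thesis
    using that irrefl by (auto simp: nbrs_def)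
qed

text \<open>Paths are lists of vertices, so a path of odd length is a list of even length.\<close>

lemma shorten_odd_path:
  assumes p: "distinct (A @ x # B @ y # C)" "successively E (A @ x # B @ y # C)"
    "even (length (A @ x # B @ y # C))"
    and ends: "linked (hd (A @ x # B @ y # C)) (last (A @ x # B @ y # C))"
    and xy: "linked x y" "2 \<le> length B" "C \<noteq> []"
  shows "\<exists>p. distinct p \<and> successively E p \<and> p \<noteq> [] \<and> even (length p) \<and> linked (hd p) (last p) \<and>
    length p < length (A @ x # B @ y # C)"
proof (cases "even (length B)")
  \<comment> \<open>The stretch from \<open>x\<close> to \<open>y\<close> is itself an odd path with
    linked ends, and \<open>C \<noteq> []\<close> makes it strictly shorter.\<close>
  case True
  then show ?thesis
    using p xy by (intro exI[of _ "x # B @ [y]"])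
      (auto simp: successively_append_iff successively_Cons hd_append)
next
  case False
  obtain z where z: "E x z" "E y z" "z \<noteq> x" "z \<noteq> y"
    using xy common_neighbour by blast
  have z': "E z x" "E z y"
    using z sym by auto
  \<comment> \<open>The detour through \<open>z\<close> replaces \<open>B\<close>, of odd length at
    least three, by a single vertex and so keeps the parity. It is available unless \<open>z\<close>
    already lies on \<open>A\<close> or \<open>C\<close>; if \<open>z\<close> lies on
    \<open>B\<close>, nothing is lost.\<close>
  consider "z \<notin> set A \<union> set C" | A1 A2 where "A = A1 @ z # A2" | C1 C2 where "C = C1 @ z # C2"
    by (metis UnE split_list)
  then show ?thesis
  proof cases
    case 1
    let ?q = "A @ x # z # y # C"
    have "hd ?q = hd (A @ x # B @ y # C)" "last ?q = last (A @ x # B @ y # C)"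
      using xy by (simp_all add: hd_append)
    moreover have "distinct ?q"
      using p(1) 1 z by auto
    moreover have "successively E ?q"
      using p(2) z(1) z'(2) by (auto simp: successively_append_iff successively_Cons)
    ultimately show ?thesis
      using p(3) ends xy False by (intro exI[of _ ?q]) auto
  next
    case 2
    \<comment> \<open>For even \<open>length A2\<close>, jumping from \<open>z\<close> to
      \<open>y\<close> drops an even number of vertices. For odd \<open>length A2\<close>, the
      stretch from \<open>z\<close> to \<open>x\<close>, preceded by \<open>y\<close>, is an odd
      path between the linked vertices \<open>y\<close> and \<open>x\<close>. The case of
      \<open>C\<close> is the mirror image.\<close>
    show ?thesis
    proof (cases "even (length A2)")
      case True
      let ?q = "A1 @ z # y # C"
      have "hd ?q = hd (A @ x # B @ y # C)" "last ?q = last (A @ x # B @ y # C)"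
        using xy 2 by (simp_all add: hd_append)
      moreover have "distinct ?q"
        using p(1) 2 by auto
      moreover have "successively E ?q"
        using p(2) 2 z z' by (auto simp: successively_append_iff successively_Cons)
      ultimately show ?thesis
        using p(3) ends xy 2 False True by (intro exI[of _ ?q]) auto
    next
      case odd: False
      let ?q = "y # z # A2 @ [x]"
      have "linked (hd ?q) (last ?q)"
        using xy linked_sym by simp
      moreover have "distinct ?q"
        using p(1) 2 z by auto
      moreover have "successively E ?q"
        using p(2) 2 z z' by (auto simp: successively_append_iff successively_Cons hd_append)
      ultimately show ?thesis
        using odd xy 2 by (intro exI[of _ ?q]) auto
    qed
  next
    case 3
    show ?thesis
    proof (cases "even (length C1)")
      case True
      let ?q = "A @ x # z # C2"
      have "hd ?q = hd (A @ x # B @ y # C)" "last ?q = last (A @ x # B @ y # C)"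
        using xy 3 by (simp_all add: hd_append)
      moreover have "distinct ?q"
        using p(1) 3 by auto
      moreover have "successively E ?q"
        using p(2) 3 z z' by (auto simp: successively_append_iff successively_Cons)
      ultimately show ?thesis
        using p(3) ends xy 3 False True by (intro exI[of _ ?q]) auto
    next
      case odd: False
      let ?q = "y # C1 @ [z, x]"
      have "linked (hd ?q) (last ?q)"
        using xy linked_sym by simp
      moreover have "distinct ?q"
        using p(1) 3 z by auto
      moreover have "successively E ?q"
        using p(2) 3 z z' by (auto simp: successively_append_iff successively_Cons hd_append)
      ultimately show ?thesis
        using odd xy 3 by (intro exI[of _ ?q]) auto
    qed
  qed
qed

lemma no_odd_path_between_linked:
  assumes "distinct p" "successively E p" "p \<noteq> []" "linked (hd p) (last p)"
  shows "odd (length p)"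
  using assms
proof (induction "length p" arbitrary: p rule: less_induct)
  case less
  show ?case
  proof
    assume even: "even (length p)"
    show False
    proof (cases "length p \<le> 2 * k")
      case True
      obtain m where m: "length p = 2 * m"
        using even by auto
      \<comment> \<open>This gives \<open>k - m < k\<close>. The \<open>2 * m\<close> vertices of
        \<open>p\<close> and the \<open>2 * (k - m) + 1\<close> vertices of \<open>q\<close> add up
        to \<open>2 * k + 1\<close>.\<close>
      have "0 < m"
        using less.prems m by (cases m) auto
      then obtain q where q: "distinct q" "length q = 2 * (k - m) + 1"
          "successively E (hd p # q @ [last p])" "set q \<inter> set p = {}"
        using even_path_between_linked[of "hd p" "last p" "set p" "k - m"] less.prems True m
        by (auto simp: distinct_card)
      have "q \<noteq> []"
        using q by auto
      then have "E (last (p @ rev q)) (hd (p @ rev q))" "successively E (p @ rev q)"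
        using q less.prems sym
        by (auto simp: successively_append_iff successively_Cons last_rev hd_rev simp del: successively_rev)
      moreover have "distinct (p @ rev q)" "length (p @ rev q) = 2 * k + 1"
        using q less.prems True m by auto
      ultimately show False
        using no_cycle by blast
    next
      case False
      \<comment> \<open>The spacing of three puts at least two vertices between any two chosen ones.
        As \<open>length p\<close> is even and exceeds \<open>2 * k\<close>, it is at least
        \<open>2 * k + 2\<close>, so a vertex remains after position \<open>3 * s\<close> and
        \<open>C\<close> below is nonempty.\<close>
      let ?I = "(\<lambda>i. p ! (3 * i)) ` {..s}"
      have len: "3 * s + 2 \<le> length p"
        using False params even by presburger
      have "card ?I = Suc s"
        using len less.prems by (subst card_image) (auto intro!: inj_onI simp: nth_eq_iff_index_eq)
      moreover have "?I \<subseteq> V"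
      proof
        fix v
        assume "v \<in> ?I"
        then obtain i where i: "i \<le> s" "v = p ! (3 * i)"
          by auto
        then have "E v (p ! Suc (3 * i))"
          using len less.prems successively_nth[of E p "3 * i"] by simp
        then show "v \<in> V"
          by (rule in_V)
      qed
      ultimately obtain i' j' where "i' \<le> s" "j' \<le> s" "linked (p ! (3 * i')) (p ! (3 * j'))"
        using large_codegree[of ?I] by (auto simp: linked_def)
      then obtain i j where ij: "i < j" "j \<le> s" "linked (p ! (3 * i)) (p ! (3 * j))"
        using linked_sym by (metis linked_def linorder_neqE_nat)
      define B where "B = take (3 * j - 3 * i - 1) (drop (Suc (3 * i)) p)"
      define C where "C = drop (Suc (3 * j)) p"
      have "p = take (3 * i) p @ p ! (3 * i) # drop (Suc (3 * i)) p"
        using ij len by (simp add: id_take_nth_drop)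
      also have "drop (Suc (3 * i)) p = B @ drop (3 * j - 3 * i - 1) (drop (Suc (3 * i)) p)"
        unfolding B_def by (rule append_take_drop_id[symmetric])
      also have "drop (3 * j - 3 * i - 1) (drop (Suc (3 * i)) p) = drop (3 * j) p"
        using ij by simp
      also have "drop (3 * j) p = p ! (3 * j) # C"
        using ij len by (simp add: C_def Cons_nth_drop_Suc)
      finally have p: "p = take (3 * i) p @ p ! (3 * i) # B @ p ! (3 * j) # C" .
      have "2 \<le> length B" "C \<noteq> []"
        using ij len by (auto simp: B_def C_def)
      then obtain p' where "distinct p'" "successively E p'" "p' \<noteq> []" "even (length p')"
          "linked (hd p') (last p')" "length p' < length p"
        using shorten_odd_path[of "take (3 * i) p" "p ! (3 * i)" B "p ! (3 * j)" C] less.prems even ij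
        unfolding p[symmetric] by blast
      then show False
        using less.hyps by blast
    qed
  qed
qed

end

section \<open>Parity-connected sets and colourings\<close>

context simple_graph
begin

section \<open>Paths and parity-connected sets\<close>

definition path_in :: "'a set \<Rightarrow> 'a \<Rightarrow> 'a list \<Rightarrow> 'a \<Rightarrow> bool" where
  "path_in B u p v \<longleftrightarrow>
    p \<noteq> [] \<and> hd p = u \<and> last p = v \<and> distinct p \<and> set p \<subseteq> B \<and> successively E p"

text \<open>Singletons qualify vacuously, so two distinct vertices are asked for wherever a genuine
  such set is needed.\<close>

definition parity_connected :: "'a set \<Rightarrow> bool" where
  "parity_connected B \<longleftrightarrow>
    (\<forall>u\<in>B. \<forall>v\<in>B. u \<noteq> v \<longrightarrow> (\<forall>b. \<exists>p. path_in B u p v \<and> even (length p) = b))"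

definition edges_in :: "'a set \<Rightarrow> ('a \<times> 'a) set" where
  "edges_in W = {(u, v). u \<in> W \<and> v \<in> W \<and> E u v}"

lemma path_in_rev: "path_in B u p v \<Longrightarrow> path_in B v (rev p) u"
  by (simp add: path_in_def hd_rev last_rev del: successively_rev)

lemma path_in_mono: "path_in B u p v \<Longrightarrow> B \<subseteq> C \<Longrightarrow> path_in C u p v"
  by (auto simp: path_in_def)

lemma sym_edges_in_rtrancl: "(u, v) \<in> (edges_in W)\<^sup>* \<Longrightarrow> (v, u) \<in> (edges_in W)\<^sup>*"
  by (rule symD[OF sym_rtrancl]) (auto simp: sym_def edges_in_def dest: sym)

lemma path_in_of_rtrancl:
  assumes "(u, v) \<in> (edges_in W)\<^sup>*" "u \<in> W"
  shows "\<exists>p. path_in W u p v"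
  using assms
proof (induction rule: rtrancl_induct)
  case base
  then show ?case
    by (intro exI[of _ "[u]"]) (auto simp: path_in_def)
next
  case (step y z)
  then obtain p where p: "path_in W u p y"
    by blast
  show ?case
  proof (cases "z \<in> set p")
    case True
    then obtain p1 p2 where "p = p1 @ z # p2"
      by (meson split_list)
    then show ?thesis
      using p by (intro exI[of _ "p1 @ [z]"])
        (auto simp: path_in_def successively_append_iff successively_Cons hd_append)
  next
    case False
    then show ?thesis
      using p step by (intro exI[of _ "p @ [z]"])
        (auto simp: path_in_def successively_append_iff edges_in_def)
  qed
qed

text \<open>A vertex of \<open>B\<close> reaches a vertex of the ear by walking inside
  \<open>B\<close> to one end and then along the ear; two vertices of the ear are joined by leaving
  it at opposite ends. The stretch inside \<open>B\<close> can be given either parity.\<close>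

lemma parity_connected_ear:
  assumes B: "parity_connected B" "u \<in> B" "v \<in> B" "u \<noteq> v"
    and zs: "distinct zs" "set zs \<inter> B = {}" "successively E (u # zs @ [v])"
  shows "parity_connected (B \<union> set zs)"
proof -
  let ?P = "\<lambda>a b e. \<exists>p. path_in (B \<union> set zs) a p b \<and> even (length p) = e"
  have swap: "?P b a e" if "?P a b e" for a b e
    using that path_in_rev by (metis length_rev)
  have inner: "?P a b e" if ab: "a \<in> B" "b \<in> B" "a \<noteq> b" for a b e
  proof -
    obtain p where "path_in B a p b" "even (length p) = e"
      using B(1) ab unfolding parity_connected_def by blast
    then show ?thesis
      using path_in_mono by (metis Un_upper1)
  qed
  have mixed: "?P w z e" if w: "w \<in> B" and z: "z \<in> set zs" for w z e
  proof -
    obtain z1 z2 where split: "zs = z1 @ z # z2"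
      using z by (meson split_list)
    show ?thesis
    proof (cases "w = u")
      case False
      \<comment> \<open>The equation between truth values selects the parity of \<open>p\<close> for
        which the whole list has parity \<open>e\<close>.\<close>
      obtain p where p: "path_in B w p u" "even (length p) = (e = even (length z1 + 1))"
        using B w False unfolding parity_connected_def by blast
      have "path_in (B \<union> set zs) w (p @ z1 @ [z]) z"
        using p(1) zs split
        by (auto simp: path_in_def successively_append_iff successively_Cons hd_append)
      then show ?thesis
        using p(2) by (intro exI[of _ "p @ z1 @ [z]"]) auto
    next
      \<comment> \<open>From \<open>u\<close> itself there is no choice of parity on the way to
        \<open>u\<close>, so the ear is entered at its other end \<open>v\<close>.\<close>
      case True
      obtain p where p: "path_in B w p v" "even (length p) = (e = even (length z2 + 1))"
        using B w True unfolding parity_connected_def by blast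
      have "successively E (rev (z # z2 @ [v]))"
        using zs split unfolding successively_E_rev
        by (auto simp: successively_append_iff successively_Cons hd_append)
      then have "successively E (v # rev z2 @ [z])"
        by (simp del: successively_rev successively_E_rev)
      then have "path_in (B \<union> set zs) w (p @ rev z2 @ [z]) z"
        using p(1) zs split
        by (auto simp: path_in_def successively_append_iff successively_Cons hd_append
            simp del: successively_rev successively_E_rev)
      then show ?thesis
        using p(2) by (intro exI[of _ "p @ rev z2 @ [z]"]) auto
    qed
  qed
  have outer: "?P z z' e" if "zs = z1 @ z # z2 @ z' # z3" for z z' z1 z2 z3 e
  proof -
    obtain p where p: "path_in B u p v" "even (length p) = (e = even (length z1 + length z3))"
      using B unfolding parity_connected_def by blast
    have "successively E (rev (u # z1 @ [z]))" "successively E (rev (z' # z3 @ [v]))"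
      using zs(3) unfolding that successively_E_rev
      by (auto simp: successively_append_iff successively_Cons hd_append split: if_splits)
    then have "successively E ((z # rev z1) @ [u])" "successively E (v # rev z3 @ [z'])"
      by (simp_all del: successively_rev successively_E_rev)
    then have "successively E ((z # rev z1) @ p @ rev z3 @ [z'])"
      using p(1) unfolding path_in_def
      by (auto simp: successively_append_iff successively_Cons last_rev hd_append
          simp del: successively_rev successively_E_rev split: if_splits)
    moreover have "distinct ((z # rev z1) @ p @ rev z3 @ [z'])"
      using p(1) zs(1,2) unfolding path_in_def that by auto
    ultimately have "path_in (B \<union> set zs) z ((z # rev z1) @ p @ rev z3 @ [z']) z'"
      using p(1) unfolding path_in_def that by auto
    then show ?thesis
      using p(2) by (intro exI[of _ "(z # rev z1) @ p @ rev z3 @ [z']"]) auto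
  qed
  have outer': "?P z z' e" if zz: "z \<in> set zs" "z' \<in> set zs" "z \<noteq> z'" for z z' e
  proof -
    obtain y1 y2 where y: "zs = y1 @ z # y2"
      using zz by (meson split_list)
    then consider "z' \<in> set y1" | "z' \<in> set y2"
      using zz by auto
    then show ?thesis
    proof cases
      case 1
      then obtain x1 x2 where "y1 = x1 @ z' # x2"
        by (meson split_list)
      then have "zs = x1 @ z' # x2 @ z # y2"
        using y by simp
      then show ?thesis
        by (rule swap[OF outer])
    next
      case 2
      then obtain x1 x2 where "y2 = x1 @ z' # x2"
        by (meson split_list)
      then have "zs = y1 @ z # x1 @ z' # x2"
        using y by simp
      then show ?thesis
        by (rule outer)
    qed
  qed
  show ?thesis
    unfolding parity_connected_def
  proof (intro ballI impI allI)
    fix a b e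
    assume ab: "a \<in> B \<union> set zs" "b \<in> B \<union> set zs" "a \<noteq> b"
    then consider "a \<in> B" "b \<in> B" | "a \<in> B" "b \<in> set zs" | "a \<in> set zs" "b \<in> B"
      | "a \<in> set zs" "b \<in> set zs"
      by blast
    then show "?P a b e"
    proof cases
      case 1
      then show ?thesis
        using ab(3) by (rule inner)
    next
      case 2
      then show ?thesis
        by (rule mixed)
    next
      case 3
      then show ?thesis
        by (intro swap[OF mixed])
    next
      case 4
      then show ?thesis
        using ab(3) by (rule outer')
    qed
  qed
qed

text \<open>The two arcs of an odd cycle between two of its vertices have lengths of different
  parity.\<close>

lemma parity_connected_odd_cycle:
  assumes c: "distinct c" "successively E c" "E (last c) (hd c)" "odd (length c)"
  shows "parity_connected (set c)"
proof -
  let ?P = "\<lambda>a b e. \<exists>p. path_in (set c) a p b \<and> even (length p) = e"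
  have ordered: "?P a b e" if split: "c = A @ a # B @ b # C" for a b A B C e
  proof -
    have 1: "path_in (set c) a (a # B @ [b]) b"
      using c split by (auto simp: path_in_def successively_append_iff successively_Cons hd_append)
    have "path_in (set c) b (b # C @ A @ [a]) a"
    proof -
      have "successively E (b # C)" "successively E (A @ [a])"
        using c(2) split by (auto simp: successively_append_iff successively_Cons)
      moreover have "last (b # C) = last c" "hd (A @ [a]) = hd c"
        using split by (auto simp: hd_append)
      ultimately have "successively E ((b # C) @ (A @ [a]))"
        using c(3) by (subst successively_append_iff) simp
      then show ?thesis
        using c(1) split by (auto simp: path_in_def)
    qed
    then have 2: "path_in (set c) a (rev (b # C @ A @ [a])) b"
      by (rule path_in_rev)
    have "even (length (a # B @ [b])) \<noteq> even (length (rev (b # C @ A @ [a])))"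
      using c split by auto
    then show ?thesis
      using 1 2 by blast
  qed
  show ?thesis
    unfolding parity_connected_def
  proof (intro ballI impI allI)
    fix a b e
    assume ab: "a \<in> set c" "b \<in> set c" "a \<noteq> b"
    obtain y1 y2 where y: "c = y1 @ a # y2"
      using ab by (meson split_list)
    then consider "b \<in> set y1" | "b \<in> set y2"
      using ab by auto
    then show "?P a b e"
    proof cases
      case 1
      then obtain x1 x2 where "y1 = x1 @ b # x2"
        by (meson split_list)
      then have "c = x1 @ b # x2 @ a # y2"
        using y by simp
      then have "?P b a e"
        by (rule ordered)
      then show ?thesis
        using path_in_rev by (metis length_rev)
    next
      case 2
      then obtain x1 x2 where "y2 = x1 @ b # x2"
        by (meson split_list)
      then have "c = y1 @ a # x1 @ b # x2"
        using y by simp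
      then show ?thesis
        by (rule ordered)
    qed
  qed
qed

section \<open>Colourings and Kempe chains\<close>

definition colourable :: "nat \<Rightarrow> 'a set \<Rightarrow> bool" where
  "colourable r U \<longleftrightarrow>
    (\<exists>c. (\<forall>v\<in>U. c v < r) \<and> (\<forall>u\<in>U. \<forall>v\<in>U. E u v \<longrightarrow> c u \<noteq> c v))"

lemma colourable_mono: "colourable r U \<Longrightarrow> W \<subseteq> U \<Longrightarrow> colourable r W"
  unfolding colourable_def by (metis subsetD)

lemma alternating_path:
  fixes c :: "'a \<Rightarrow> nat"
  assumes "p \<noteq> []" "successively E p" "\<And>v. v \<in> set p \<Longrightarrow> c v < 2"
    "\<And>u v. u \<in> set p \<Longrightarrow> v \<in> set p \<Longrightarrow> E u v \<Longrightarrow> c u \<noteq> c v"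
  shows "even (length p) \<longleftrightarrow> c (hd p) \<noteq> c (last p)"
  using assms
proof (induction p)
  case (Cons x p)
  show ?case
  proof (cases "p = []")
    case False
    have "c x \<noteq> c (hd p)" "c x < 2" "c (hd p) < 2" "c (last p) < 2"
      using Cons.prems False by (auto simp: successively_Cons)
    then have "c x \<noteq> c (last p) \<longleftrightarrow> c (hd p) = c (last p)"
      by arith
    moreover have "even (length p) \<longleftrightarrow> c (hd p) \<noteq> c (last p)"
      using Cons.prems False by (intro Cons.IH) (auto simp: successively_Cons)
    ultimately show ?thesis
      using False by simp
  qed simp
qed simp

text \<open>A Kempe chain from \<open>x\<close> back to \<open>x\<close> is an odd cycle.\<close>

lemma parity_connected_of_critical:
  assumes "x \<in> U" "colourable r (U - {x})" "\<not> colourable r U" "2 \<le> r"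
  shows "\<exists>C\<subseteq>U. parity_connected C \<and> (\<exists>u\<in>C. \<exists>v\<in>C. u \<noteq> v)"
proof -
  obtain c where c: "\<And>v. v \<in> U - {x} \<Longrightarrow> c v < r"
      "\<And>u v. u \<in> U - {x} \<Longrightarrow> v \<in> U - {x} \<Longrightarrow> E u v \<Longrightarrow> c u \<noteq> c v"
    using assms unfolding colourable_def by blast
  define W where "W = {v \<in> U - {x}. c v < 2}"
  \<comment> \<open>This is the union of the Kempe chains in the colours 0 and 1 through the
    neighbours of \<open>x\<close> of colour 0.\<close>
  define K where "K = (edges_in W)\<^sup>* `` {u \<in> W. E x u \<and> c u = 0}"
  have K_W: "K \<subseteq> W"
  proof
    fix w
    assume "w \<in> K"
    then obtain u where "u \<in> W" "(u, w) \<in> (edges_in W)\<^sup>*"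
      by (auto simp: K_def)
    then show "w \<in> W"
      by (auto elim: rtranclE simp: edges_in_def)
  qed
  have K_step: "w \<in> K" if "v \<in> K" "w \<in> W" "E v w" for v w
  proof -
    have "(v, w) \<in> edges_in W"
      using that K_W by (auto simp: edges_in_def)
    then show ?thesis
      using that by (auto simp: K_def intro: rtrancl_into_rtrancl)
  qed
  \<comment> \<open>Otherwise exchanging 0 and 1 on \<open>K\<close> would free colour 0 for
    \<open>x\<close> and colour all of \<open>U\<close>.\<close>
  have "\<exists>w\<in>K. E x w \<and> c w = 1"
  proof (rule ccontr)
    assume "\<not> (\<exists>w\<in>K. E x w \<and> c w = 1)"
    then have *: "\<And>w. w \<in> K \<Longrightarrow> E x w \<Longrightarrow> c w = 0"
      using K_W unfolding W_def by (metis (no_types, lifting) One_nat_def less_2_cases mem_Collect_eq subsetD)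
    define c' where "c' v = (if v = x then 0 else if v \<in> K then 1 - c v else c v)" for v
    have x: "c' v \<noteq> 0" if "v \<in> U" "E x v" for v
    proof (cases "v \<in> K")
      case True
      then show ?thesis
        using * that irrefl by (auto simp: c'_def)
    next
      case False
      have "v \<noteq> x"
        using that irrefl by auto
      moreover have "c v \<noteq> 0"
        using False that \<open>v \<noteq> x\<close> by (auto simp: K_def W_def)
      ultimately show ?thesis
        using False by (simp add: c'_def)
    qed
    have one: "c' u \<noteq> c' v" if "u \<in> K" "v \<in> U" "E u v" for u v
    proof -
      have u: "u \<in> W" "c u < 2" "u \<noteq> x"
        using that K_W by (auto simp: W_def)
      show ?thesis
      proof (cases "v = x")
        case True
        then show ?thesis
          using x[of u] that u sym by (auto simp: c'_def W_def)
      next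
        case vx: False
        show ?thesis
        proof (cases "v \<in> K")
          case True
          then have "c v < 2" "c u \<noteq> c v"
            using K_W c(2)[of u v] that u by (auto simp: W_def)
          then show ?thesis
            using True that u vx by (auto simp: c'_def)
        next
          case False
          then have "\<not> c v < 2"
            using K_step[of u v] that vx by (auto simp: W_def)
          then show ?thesis
            using False that u vx by (auto simp: c'_def)
        qed
      qed
    qed
    have "c' u \<noteq> c' v" if "u \<in> U" "v \<in> U" "E u v" for u v
    proof -
      consider "u \<in> K" | "v \<in> K" | "u = x" | "v = x" | "u \<notin> K" "v \<notin> K" "u \<noteq> x" "v \<noteq> x"
        by blast
      then show ?thesis
      proof cases
        case 3
        then show ?thesis
          using x[of v] that by (auto simp: c'_def)
      next
        case 4
        then show ?thesis
          using x[of u] that sym by (auto simp: c'_def)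
      qed (use one[of u v] one[of v u] that sym c(2)[of u v] in \<open>auto simp: c'_def\<close>)
    qed
    moreover have "c' v < r" if "v \<in> U" for v
      using c(1)[of v] that assms by (auto simp: c'_def)
    ultimately have "colourable r U"
      unfolding colourable_def by blast
    then show False
      using assms by blast
  qed
  then obtain u w where uw: "u \<in> W" "E x u" "c u = 0" "(u, w) \<in> (edges_in W)\<^sup>*" "E x w" "c w = 1"
    by (auto simp: K_def)
  then obtain p where p: "path_in W u p w"
    using path_in_of_rtrancl by blast
  \<comment> \<open>Colours alternate along the chain from colour 0 to colour 1, so \<open>p\<close>
    has an even number of vertices and closes up through \<open>x\<close> to an odd cycle.\<close>
  have "even (length p) \<longleftrightarrow> c (hd p) \<noteq> c (last p)"
    using p c by (intro alternating_path) (auto simp: path_in_def W_def)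
  then have "even (length p)"
    using p uw by (simp add: path_in_def)
  moreover have "x \<notin> set p"
    using p by (auto simp: path_in_def W_def)
  ultimately have "parity_connected (set (x # p))"
    using p uw sym by (intro parity_connected_odd_cycle) (auto simp: path_in_def successively_Cons)
  moreover have "set (x # p) \<subseteq> U"
    using p assms by (auto simp: path_in_def W_def)
  moreover have "u \<in> set (x # p)" "w \<in> set (x # p)" "u \<noteq> w"
    using p uw by (auto simp: path_in_def)
  ultimately show ?thesis
    by blast
qed

section \<open>Maximal parity-connected sets and the pieces hanging off them\<close>

definition maximal_in :: "'a set \<Rightarrow> 'a set \<Rightarrow> bool" where
  "maximal_in U B \<longleftrightarrow> B \<subseteq> U \<and> parity_connected B \<and>
    (\<forall>C. B \<subseteq> C \<longrightarrow> C \<subseteq> U \<longrightarrow> parity_connected C \<longrightarrow> C = B)"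

text \<open>For \<open>v\<close> in \<open>B\<close> this is the piece rooted at \<open>v\<close>:
  the root and those components of the graph on \<open>U - B\<close> that contain a neighbour of
  it.\<close>

definition hanging :: "'a set \<Rightarrow> 'a set \<Rightarrow> 'a \<Rightarrow> 'a set" where
  "hanging U B v = insert v {z \<in> U - B. \<exists>y \<in> U - B. E v y \<and> (y, z) \<in> (edges_in (U - B))\<^sup>*}"

lemma ex_maximal_in:
  assumes "finite U" "C \<subseteq> U" "parity_connected C"
  shows "\<exists>B. C \<subseteq> B \<and> maximal_in U B"
proof -
  have "finite {B. B \<subseteq> U \<and> parity_connected B}"
    using assms by simp
  then obtain B where "B \<in> {B. B \<subseteq> U \<and> parity_connected B}" "C \<subseteq> B"
      "\<forall>C\<in>{B. B \<subseteq> U \<and> parity_connected B}. B \<le> C \<longrightarrow> B = C"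
    using finite_has_maximal2[of "{B. B \<subseteq> U \<and> parity_connected B}" C] assms by blast
  then show ?thesis
    unfolding maximal_in_def by blast
qed

lemma hanging_self: "v \<in> hanging U B v"
  by (simp add: hanging_def)

lemma hanging_neighbour: "v \<in> B \<Longrightarrow> z \<in> U - B \<Longrightarrow> E v z \<Longrightarrow> z \<in> hanging U B v"
  by (auto simp: hanging_def)

lemma hanging_subset: "v \<in> B \<Longrightarrow> B \<subseteq> U \<Longrightarrow> hanging U B v \<subseteq> insert v (U - B)"
  by (auto simp: hanging_def)

text \<open>A common vertex would give a path outside \<open>B\<close> from a neighbour of
  \<open>u\<close> to a neighbour of \<open>v\<close>. That path is an ear, and adding it
  contradicts maximality.\<close>

lemma hanging_disjoint:
  assumes max: "maximal_in U B" and uv: "u \<in> B" "v \<in> B" "u \<noteq> v"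
  shows "hanging U B u \<inter> hanging U B v = {}"
proof (rule ccontr)
  assume "hanging U B u \<inter> hanging U B v \<noteq> {}"
  then obtain z y y' where y: "y \<in> U - B" "E u y" "(y, z) \<in> (edges_in (U - B))\<^sup>*"
      and y': "y' \<in> U - B" "E v y'" "(y', z) \<in> (edges_in (U - B))\<^sup>*"
    using uv by (auto simp: hanging_def)
  have "(y, y') \<in> (edges_in (U - B))\<^sup>*"
    using y y' sym_edges_in_rtrancl rtrancl_trans by metis
  then obtain p where p: "path_in (U - B) y p y'"
    using path_in_of_rtrancl y by blast
  then have "parity_connected (B \<union> set p)"
    using max uv y y' sym by (intro parity_connected_ear[of B u v])
      (auto simp: path_in_def maximal_in_def successively_append_iff successively_Cons)
  moreover have "B \<union> set p \<subseteq> U"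
    using p max by (auto simp: path_in_def maximal_in_def)
  ultimately have "B \<union> set p = B"
    using max unfolding maximal_in_def by blast
  moreover have "y \<in> set p"
    using p by (auto simp: path_in_def)
  ultimately show False
    using y by blast
qed

text \<open>If \<open>w\<close> lies in \<open>B\<close>, then \<open>z\<close> also hangs off
  \<open>w\<close>, and disjointness of the pieces forces \<open>w = v\<close>. Otherwise
  \<open>w\<close> is in the same component as \<open>z\<close>.\<close>

lemma hanging_closed:
  assumes max: "maximal_in U B" and v: "v \<in> B" and z: "z \<in> hanging U B v" "z \<noteq> v"
    and w: "w \<in> U" "E z w"
  shows "w \<in> hanging U B v"
proof (cases "w \<in> B")
  case True
  have "z \<in> U - B"
    using z by (auto simp: hanging_def)
  then have "z \<in> hanging U B w"
    using True w sym by (intro hanging_neighbour) auto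
  then have "w = v"
    using hanging_disjoint[OF max True v] z by blast
  then show ?thesis
    by (simp add: hanging_self)
next
  case False
  have "z \<in> U - B"
    using z by (auto simp: hanging_def)
  then have "(z, w) \<in> edges_in (U - B)"
    using False w by (auto simp: edges_in_def)
  then show ?thesis
    using z w False by (auto simp: hanging_def intro: rtrancl_into_rtrancl)
qed

text \<open>Edges between different pieces join roots, and no edge joins a piece to the rest. So
  each piece may be recoloured on its own, and exchanging two colours makes its root agree with the
  colouring of \<open>B\<close>.\<close>

lemma colourable_glue:
  assumes max: "maximal_in U B" and B: "colourable r B"
    and hang: "\<And>v. v \<in> B \<Longrightarrow> colourable r (hanging U B v)"
    and rest: "colourable r (U - (\<Union>v\<in>B. hanging U B v))"
  shows "colourable r U"
proof -
  let ?H = "hanging U B"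
  let ?L = "U - (\<Union>v\<in>B. ?H v)"
  obtain c0 where c0: "\<And>v. v \<in> B \<Longrightarrow> c0 v < r"
      "\<And>u v. u \<in> B \<Longrightarrow> v \<in> B \<Longrightarrow> E u v \<Longrightarrow> c0 u \<noteq> c0 v"
    using B unfolding colourable_def by blast
  obtain cL where cL: "\<And>v. v \<in> ?L \<Longrightarrow> cL v < r"
      "\<And>u v. u \<in> ?L \<Longrightarrow> v \<in> ?L \<Longrightarrow> E u v \<Longrightarrow> cL u \<noteq> cL v"
    using rest unfolding colourable_def by blast
  have "\<forall>v\<in>B. \<exists>c. (\<forall>z\<in>?H v. c z < r) \<and> (\<forall>z\<in>?H v. \<forall>w\<in>?H v. E z w \<longrightarrow> c z \<noteq> c w)"
    using hang unfolding colourable_def by blast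
  then obtain cv where cv: "\<And>v z. v \<in> B \<Longrightarrow> z \<in> ?H v \<Longrightarrow> cv v z < r"
      "\<And>v z w. v \<in> B \<Longrightarrow> z \<in> ?H v \<Longrightarrow> w \<in> ?H v \<Longrightarrow> E z w \<Longrightarrow> cv v z \<noteq> cv v w"
    by metis
  define own where "own z = (SOME v. v \<in> B \<and> z \<in> ?H v)" for z
  have own: "own z = v" if "v \<in> B" "z \<in> ?H v" for v z
  proof -
    have "own z \<in> B \<and> z \<in> ?H (own z)"
      unfolding own_def by (rule someI[of _ v]) (use that in blast)
    then show ?thesis
      using hanging_disjoint[OF max] that by blast
  qed
  define c where "c z = (if z \<in> ?L then cL z
    else transpose (cv (own z) (own z)) (c0 (own z)) (cv (own z) z))" for z
  have c_H: "c z = transpose (cv v v) (c0 v) (cv v z)" if "v \<in> B" "z \<in> ?H v" for v z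
    using that own by (auto simp: c_def)
  have c_B: "c v = c0 v" if "v \<in> B" for v
    using c_H[OF that hanging_self] by simp
  have lt: "c z < r" if z: "z \<in> U" for z
  proof (cases "z \<in> ?L")
    case True
    then show ?thesis
      using cL by (simp add: c_def)
  next
    case False
    then obtain v where v: "v \<in> B" "z \<in> ?H v"
      using z by blast
    then have "cv v z < r" "cv v v < r" "c0 v < r"
      using cv c0 hanging_self by auto
    then show ?thesis
      using c_H[OF v] by (simp add: transpose_def)
  qed
  have leave: "w \<in> B \<and> z = v \<or> w \<in> ?H v" if "v \<in> B" "z \<in> ?H v" "w \<in> U" "E z w" for v z w
    using hanging_closed[OF max, of v z w] hanging_neighbour[of v B w U] that by blast
  have "c z \<noteq> c w" if zw: "z \<in> U" "w \<in> U" "E z w" for z w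
  proof -
    have same: "c z \<noteq> c w" if v: "v \<in> B" "z \<in> ?H v" "w \<in> ?H v" for v
      using cv(2)[OF v] c_H v zw by (simp add: inj_eq[OF inj_on_transpose])
    have clash: "w \<in> (\<Union>v\<in>B. ?H v)" if zw: "z \<in> (\<Union>v\<in>B. ?H v)" "w \<in> U" "E z w" for z w
    proof -
      obtain v where "v \<in> B" "z \<in> ?H v"
        using zw by blast
      then have "w \<in> B \<or> w \<in> ?H v"
        using leave[of v z w] zw by blast
      then show ?thesis
        using \<open>v \<in> B\<close> hanging_self[of w U B] by blast
    qed
    show ?thesis
    proof (cases "z \<in> ?L")
      case True
      then have "w \<in> ?L"
        using clash[of w z] zw sym by blast
      then show ?thesis
        using True cL zw by (simp add: c_def)
    next
      case False
      then obtain v where v: "v \<in> B" "z \<in> ?H v"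
        using zw by blast
      consider "w \<in> ?H v" | "w \<in> B" "z = v"
        using leave v zw by blast
      then show ?thesis
      proof cases
        case 2
        then show ?thesis
          using c_B c0 v zw by simp
      qed (use same v in blast)
    qed
  qed
  then show ?thesis
    using lt unfolding colourable_def by blast
qed

text \<open>In a minimal uncolourable \<open>U\<close> every vertex is critical, so a Kempe chain
  yields a parity-connected set with two distinct vertices. For a maximal \<open>B\<close>
  containing it, the pieces and the rest are proper subsets of \<open>U\<close>, hence colourable,
  and these colourings glue with that of \<open>B\<close>.\<close>

lemma colourable_if_parity_connected_colourable:
  assumes "finite U" "2 \<le> r" "\<And>B. B \<subseteq> U \<Longrightarrow> parity_connected B \<Longrightarrow> colourable r B"
  shows "colourable r U"
  using assms(1,3)
proof (induction U rule: finite_psubset_induct)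
  case (psubset U)
  have proper: "colourable r W" if "W \<subset> U" for W
    using psubset that by (meson order_trans psubset_imp_subset)
  show ?case
  proof (rule ccontr)
    assume neg: "\<not> colourable r U"
    then obtain x where "x \<in> U"
      by (auto simp: colourable_def)
    then obtain C where C: "C \<subseteq> U" "parity_connected C" "\<exists>u\<in>C. \<exists>v\<in>C. u \<noteq> v"
      using parity_connected_of_critical[of x U r] proper[of "U - {x}"] neg assms by blast
    then obtain B where B: "C \<subseteq> B" "maximal_in U B"
      using ex_maximal_in[OF psubset.hyps(1) C(1,2)] by blast
    then have BU: "B \<subseteq> U"
      by (simp add: maximal_in_def)
    have "colourable r (hanging U B v)" if v: "v \<in> B" for v
    proof -
      \<comment> \<open>A second vertex of \<open>B\<close> lies outside the piece at
        \<open>v\<close>, which is therefore a proper subset of \<open>U\<close>.\<close>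
      obtain u where "u \<in> B" "u \<noteq> v"
        using C(3) B(1) by (metis subsetD)
      then show ?thesis
        using hanging_subset[OF v BU] v BU by (intro proper) blast
    qed
    moreover have "colourable r (U - (\<Union>v\<in>B. hanging U B v))"
    proof (rule proper)
      obtain v where "v \<in> B"
        using C(3) B(1) by blast
      then show "U - (\<Union>v\<in>B. hanging U B v) \<subset> U"
        using hanging_self BU by blast
    qed
    moreover have "colourable r B"
      using psubset.prems B by (simp add: maximal_in_def)
    ultimately show False
      using colourable_glue[OF B(2)] neg by blast
  qed
qed

end

section \<open>The extremal structure\<close>

text \<open>This numbers one side of a piece so that the root gets index 0, as the selected vertices
  of \<open>bipartite_copies_clique\<close> require.\<close>

lemma bij_betw_with_base:
  assumes "finite X" "card X = m" "v \<in> X"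
  shows "\<exists>g :: 'a \<Rightarrow> nat. bij_betw g X {..<m} \<and> g v = 0"
proof -
  obtain h :: "'a \<Rightarrow> nat" where h: "bij_betw h X {..<m}"
    using assms by (metis card_lessThan finite_lessThan finite_same_card_bij)
  have "h v \<in> {..<m}" "0 \<in> {..<m}"
    using h assms by (auto simp: bij_betw_def)
  then have "bij_betw (transpose (h v) 0) {..<m} {..<m}"
    by (intro bij_betw_transpose_iff) simp
  then have "bij_betw (transpose (h v) 0 \<circ> h) X {..<m}"
    using h by (rule bij_betw_trans[rotated])
  then show ?thesis
    by (intro exI[of _ "transpose (h v) 0 \<circ> h"]) simp
qed

text \<open>Two nonadjacent vertices could share a colour, so \<open>r + 1\<close> vertices escape
  \<open>r\<close> colours only as a clique.\<close>

lemma (in simple_graph) not_colourable_small: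
  assumes B: "finite B" "card B \<le> Suc r" "\<not> colourable r B"
  shows "card B = Suc r" "u \<in> B \<Longrightarrow> v \<in> B \<Longrightarrow> u \<noteq> v \<Longrightarrow> E u v"
proof -
  have colour: "colourable r B" if C: "finite C" "card C \<le> r" "\<And>v. v \<in> B \<Longrightarrow> f v \<in> C"
    "\<And>u v. u \<in> B \<Longrightarrow> v \<in> B \<Longrightarrow> E u v \<Longrightarrow> f u \<noteq> f v" for f and C :: "'a set"
  proof -
    obtain g :: "'a \<Rightarrow> nat" where g: "bij_betw g C {..<card C}"
      using C(1) by (metis card_lessThan finite_lessThan finite_same_card_bij)
    have "g (f v) < r" if "v \<in> B" for v
      using bij_betw_apply[OF g C(3)[OF that]] C(2) by simp
    moreover have "g (f u) \<noteq> g (f v)" if "u \<in> B" "v \<in> B" "E u v" for u v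
      using g C(3,4) that by (metis bij_betw_def inj_on_eq_iff)
    ultimately show ?thesis
      unfolding colourable_def by (intro exI[of _ "g \<circ> f"]) auto
  qed
  show card: "card B = Suc r"
  proof (rule ccontr)
    assume "card B \<noteq> Suc r"
    then show False
      using colour[of B id] B irrefl by fastforce
  qed
  show "E u v" if uv: "u \<in> B" "v \<in> B" "u \<noteq> v"
  proof (rule ccontr)
    assume neg: "\<not> E u v"
    have "colourable r B"
    \<comment> \<open>The vertices other than \<open>u\<close> serve as colours, and
      \<open>u\<close> takes the colour of its non-neighbour \<open>v\<close>.\<close>
    proof (rule colour[of "B - {u}" "id(u := v)"])
      show "card (B - {u}) \<le> r"
        using card uv B by simp
    qed (use uv B neg irrefl sym in \<open>auto simp: fun_upd_def split: if_splits\<close>)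
    then show False
      using B by blast
  qed
qed

context odd_cycle_free_graph
begin

section \<open>Consequences of the absence of odd paths between linked vertices\<close>

lemma card_unlinked_le:
  assumes "I \<subseteq> V" "\<And>x y. x \<in> I \<Longrightarrow> y \<in> I \<Longrightarrow> \<not> linked x y"
  shows "card I \<le> s"
proof (rule ccontr)
  assume "\<not> card I \<le> s"
  then obtain J where "J \<subseteq> I" "card J = Suc s"
    by (metis not_less_eq_eq obtain_subset_with_card_n)
  then show False
    using assms large_codegree[of J] unfolding linked_def by blast
qed

lemma linked_pair_in:
  assumes "I \<subseteq> V" "s < card I"
  shows "\<exists>x\<in>I. \<exists>y\<in>I. linked x y"
  using card_unlinked_le[OF assms(1)] assms(2) by (meson not_le)

lemma linked_not_adjacent:
  assumes "linked x y"
  shows "\<not> E x y"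
proof
  assume "E x y"
  moreover have "x \<noteq> y"
    using assms by (simp add: linked_def)
  ultimately show False
    using no_odd_path_between_linked[of "[x, y]"] assms by simp
qed

text \<open>A triangle \<open>z\<close>, \<open>y\<close>, \<open>w\<close> would yield the odd path
  \<open>[y, w, z, y']\<close> between linked vertices.\<close>

lemma nbrs_disjoint_if_linked:
  assumes "linked y y'" "E z y" "E z y'"
  shows "nbrs z \<inter> nbrs y = {}"
proof (rule ccontr)
  assume "nbrs z \<inter> nbrs y \<noteq> {}"
  then obtain w where w: "E z w" "E y w"
    by (auto simp: nbrs_def)
  have "y \<noteq> y'" "w \<noteq> y'"
    using assms w linked_not_adjacent by (auto simp: linked_def)
  moreover have "y \<noteq> z" "w \<noteq> z" "w \<noteq> y" "y' \<noteq> z"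
    using assms w irrefl by auto
  ultimately have "odd (length [y, w, z, y'])"
    using assms w sym by (intro no_odd_path_between_linked) auto
  then show False
    by simp
qed

lemma parity_connected_not_linked:
  assumes "parity_connected B" "x \<in> B" "y \<in> B"
  shows "\<not> linked x y"
proof
  assume l: "linked x y"
  then have "x \<noteq> y"
    by (simp add: linked_def)
  then obtain p where "path_in B x p y" "even (length p)"
    using assms unfolding parity_connected_def by metis
  then show False
    using no_odd_path_between_linked[of p] l by (auto simp: path_in_def)
qed

lemma card_parity_connected_le:
  assumes "parity_connected B" "B \<subseteq> V"
  shows "card B \<le> s"
  using assms parity_connected_not_linked by (intro card_unlinked_le) auto

lemma independent_common_neighbours:
  assumes "Z \<subseteq> nbrs x \<inter> nbrs x'" "t \<le> card Z"
  shows "\<not> E x x'"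
proof
  assume E: "E x x'"
  then have "x \<noteq> x'"
    using irrefl by auto
  moreover have "t \<le> card (nbrs x \<inter> nbrs x')"
    using assms card_mono[of "nbrs x \<inter> nbrs x'" Z] by simp
  ultimately have "linked x x'"
    by (simp add: linked_def)
  then show False
    using E linked_not_adjacent by blast
qed

text \<open>Two disjoint neighbourhoods of at least \<open>m\<close> vertices inside a set of
  \<open>2 * m\<close> vertices partition it, and they turn out to be the two sides. The root
  \<open>v\<close> is treated apart because its neighbourhood may leave \<open>T\<close>.\<close>

lemma tight_piece_bipartite:
  assumes T: "finite T" "card T = 2 * m" "v \<in> T" "T \<noteq> {v}"
    and closed: "\<And>z. z \<in> T \<Longrightarrow> z \<noteq> v \<Longrightarrow> nbrs z \<subseteq> T"
    and deg: "\<And>z. z \<in> T \<Longrightarrow> m \<le> card (nbrs z)"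
    and m: "s + t + 1 < m"
  shows "\<exists>X Y. T = X \<union> Y \<and> X \<inter> Y = {} \<and> card X = m \<and> card Y = m \<and> v \<in> X \<and>
    (\<forall>z\<in>T. \<forall>w\<in>T. E z w \<longleftrightarrow> (z \<in> X \<and> w \<in> Y \<or> z \<in> Y \<and> w \<in> X))"
proof -
  \<comment> \<open>More than \<open>s\<close> neighbours of \<open>z\<close> differ from
    \<open>v\<close>, so two of them are linked, and a linked neighbour of \<open>z\<close> shares
    no neighbour with \<open>z\<close>.\<close>
  have partner: "\<exists>y. y \<in> nbrs z \<and> y \<noteq> v \<and> nbrs z \<inter> nbrs y = {}" if z: "z \<in> T" for z
  proof -
    have "s < card (nbrs z - {v})"
      using deg[OF z] m by (cases "v \<in> nbrs z") simp_all
    moreover have "nbrs z - {v} \<subseteq> V"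
      using nbrs_subset[of z] by blast
    ultimately obtain y y' where "y \<in> nbrs z - {v}" "y' \<in> nbrs z" "linked y y'"
      using linked_pair_in[of "nbrs z - {v}"] by blast
    then show ?thesis
      using nbrs_disjoint_if_linked[of y y' z] by (auto simp: nbrs_def)
  qed
  have split: "card (nbrs z) = m" "card (nbrs y) = m" "T = nbrs z \<union> nbrs y"
    if zy: "z \<in> T" "z \<noteq> v" "y \<in> T" "y \<noteq> v" "nbrs z \<inter> nbrs y = {}" for z y
  proof -
    have sub: "nbrs z \<union> nbrs y \<subseteq> T"
      using closed zy by simp
    have "card (nbrs z \<union> nbrs y) = card (nbrs z) + card (nbrs y)"
      using zy by (intro card_Un_disjoint) auto
    moreover have "card (nbrs z \<union> nbrs y) \<le> 2 * m"
      using card_mono[OF T(1) sub] T by simp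
    ultimately show c: "card (nbrs z) = m" "card (nbrs y) = m"
      using deg[of z] deg[of y] zy by linarith+
    show "T = nbrs z \<union> nbrs y"
      using T sub zy c by (intro card_subset_eq[symmetric]) (simp_all add: card_Un_disjoint)
  qed
  have regular: "card (nbrs z) = m" if "z \<in> T" "z \<noteq> v" for z
    using partner[of z] split(1)[of z] closed[of z] that by blast
  obtain z0 where z0: "z0 \<in> T" "z0 \<noteq> v"
    using T by blast
  then obtain y0 where y0: "y0 \<in> nbrs z0" "y0 \<noteq> v" "nbrs z0 \<inter> nbrs y0 = {}"
    using partner by blast
  have y0T: "y0 \<in> T"
    using closed z0 y0 by blast
  have half: "\<not> E x x'"
    if ab: "a \<in> T" "a \<noteq> v" "b \<in> T" "b \<noteq> v" "nbrs a \<inter> nbrs b = {}"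
      and x: "x \<in> nbrs b" "x' \<in> nbrs b" for a b x x'
  proof -
    have T_eq: "T = nbrs a \<union> nbrs b" "card (nbrs a) = m" "card (nbrs b) = m"
      using split[OF ab] by simp_all
    \<comment> \<open>A vertex \<open>y\<close> of \<open>nbrs a\<close> linked to another one has
      its \<open>m\<close> neighbours outside \<open>nbrs a\<close>, so they fill
      \<open>nbrs b\<close>. Hence \<open>?I\<close> is pairwise unlinked and has at most
      \<open>s\<close> vertices. The remaining set \<open>?Z\<close> has at least \<open>t\<close>
      vertices, all adjacent to everything in \<open>nbrs b\<close>, which is therefore
      independent.\<close>
    let ?I = "{y \<in> nbrs a - {v}. nbrs y \<noteq> nbrs b}"
    let ?Z = "{y \<in> nbrs a - {v}. nbrs y = nbrs b}"
    have "\<not> linked y y'" if y: "y \<in> ?I" "y' \<in> ?I" for y y'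
    proof
      assume "linked y y'"
      then have "nbrs a \<inter> nbrs y = {}"
        using y by (intro nbrs_disjoint_if_linked) (auto simp: nbrs_def)
      moreover have "y \<in> T" "y \<noteq> v"
        using T_eq y by auto
      ultimately have "nbrs y \<subseteq> nbrs b" "card (nbrs y) = m"
        using closed[of y] regular T_eq by auto
      then have "nbrs y = nbrs b"
        using T_eq by (intro card_subset_eq) auto
      then show False
        using y by simp
    qed
    then have "card ?I \<le> s"
      using nbrs_subset by (intro card_unlinked_le) auto
    moreover have "card (nbrs a - {v}) = card ?I + card ?Z"
      by (subst card_Un_disjoint[symmetric]) (auto intro: arg_cong[where f = card])
    moreover have "m \<le> card (nbrs a - {v}) + 1"
      using T_eq by (cases "v \<in> nbrs a") simp_all
    ultimately have "t \<le> card ?Z"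
      using m by linarith
    moreover have "?Z \<subseteq> nbrs x \<inter> nbrs x'"
    proof
      fix y
      assume "y \<in> ?Z"
      then have "E y x" "E y x'"
        using x by (auto simp: nbrs_def)
      then show "y \<in> nbrs x \<inter> nbrs x'"
        using sym by (auto simp: nbrs_def)
    qed
    ultimately show ?thesis
      by (rule independent_common_neighbours[rotated])
  qed
  \<comment> \<open>With \<open>v\<close> in \<open>nbrs b\<close>, each vertex of
    \<open>nbrs a\<close> differs from \<open>v\<close>. Its neighbourhood is an
    \<open>m\<close>-subset of \<open>T\<close> that misses the independent set
    \<open>nbrs a\<close>, so it is all of \<open>nbrs b\<close>. The adjacencies of
    \<open>v\<close> inside \<open>T\<close> follow by symmetry.\<close>
  have main: ?thesis
    if ab: "a \<in> T" "a \<noteq> v" "b \<in> T" "b \<noteq> v" "nbrs a \<inter> nbrs b = {}" "v \<in> nbrs b" for a b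
  proof -
    have T_eq: "T = nbrs a \<union> nbrs b" "card (nbrs a) = m" "card (nbrs b) = m"
      using split[OF ab(1-5)] by simp_all
    have X: "\<not> E x x'" if "x \<in> nbrs b" "x' \<in> nbrs b" for x x'
      using half[OF ab(1-5)] that by blast
    have Y: "\<not> E y y'" if "y \<in> nbrs a" "y' \<in> nbrs a" for y y'
      using half[OF ab(3,4,1,2)] ab(5) that by blast
    have nY: "nbrs y = nbrs b" if y: "y \<in> nbrs a" for y
    proof -
      have "y \<in> T" "y \<noteq> v"
        using y ab T_eq by auto
      then have "nbrs y \<subseteq> T" "card (nbrs y) = m"
        using closed regular by auto
      moreover have "nbrs y \<inter> nbrs a = {}"
        using Y[OF y] by (auto simp: nbrs_def)
      ultimately show ?thesis
        using T_eq by (intro card_subset_eq) auto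
    qed
    have cross: "E y x" if "y \<in> nbrs a" "x \<in> nbrs b" for x y
      using nY[OF that(1)] that(2) unfolding nbrs_def by blast
    have adj: "E z w \<longleftrightarrow> (z \<in> nbrs b \<and> w \<in> nbrs a \<or> z \<in> nbrs a \<and> w \<in> nbrs b)"
      if "z \<in> T" "w \<in> T" for z w
    proof -
      have "z \<in> nbrs b \<and> z \<notin> nbrs a \<or> z \<in> nbrs a \<and> z \<notin> nbrs b"
          "w \<in> nbrs b \<and> w \<notin> nbrs a \<or> w \<in> nbrs a \<and> w \<notin> nbrs b"
        using that T_eq(1) ab(5) by blast+
      then show ?thesis
        using X[of z w] Y[of z w] cross[of z w] cross[of w z] sym[of w z] by argo
    qed
    show ?thesis
    proof (intro exI conjI ballI)
      show "T = nbrs b \<union> nbrs a" "nbrs b \<inter> nbrs a = {}"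
        using T_eq(1) ab(5) by blast+
      show "v \<in> nbrs b" "card (nbrs b) = m" "card (nbrs a) = m"
        using ab(6) T_eq by auto
    qed (rule adj)
  qed
  have "v \<in> nbrs z0 \<union> nbrs y0"
    using split(3)[OF z0 y0T y0(2,3)] T(3) by simp
  then show ?thesis
  proof
    assume "v \<in> nbrs y0"
    then show ?thesis
      by (rule main[OF z0 y0T y0(2,3)])
  next
    have "nbrs y0 \<inter> nbrs z0 = {}"
      using y0(3) by (simp add: Int_commute)
    moreover assume "v \<in> nbrs z0"
    ultimately show ?thesis
      by (rule main[OF y0T y0(2) z0])
  qed
qed

theorem colourable_or_extremal:
  assumes s: "s = 2 * Suc r" "2 \<le> r" and m: "s + t + 1 < m"
    and deg: "\<And>v. v \<in> V \<Longrightarrow> m \<le> card (nbrs v)" and n: "card V \<le> s * m"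
    and neg: "\<not> colourable r V"
  shows "card V = s * m" "\<exists>f. bij_betw f V ({..<Suc r} \<times> UNIV \<times> {..<m}) \<and>
    (\<forall>a\<in>V. \<forall>b\<in>V. E a b \<longleftrightarrow> (f a, f b) \<in> parcs (bipartite_copies_clique (Suc r) m))"
proof -
  obtain B0 where B0: "B0 \<subseteq> V" "parity_connected B0" "\<not> colourable r B0"
    using colourable_if_parity_connected_colourable[OF finite_V] s neg by blast
  then obtain B where B0_B: "B0 \<subseteq> B" and max: "maximal_in V B"
    using ex_maximal_in[OF finite_V B0(1,2)] by blast
  then have B: "B \<subseteq> V" "parity_connected B"
    by (simp_all add: maximal_in_def)
  moreover have "\<not> colourable r B"
    using B0(3) B0_B colourable_mono by blast
  moreover have "finite B"
    using B(1) finite_V finite_subset by blast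
  ultimately have B: "B \<subseteq> V" "parity_connected B" "\<not> colourable r B" "finite B"
    by blast+
  define T where "T = hanging V B"
  have T_V: "T v \<subseteq> V" "v \<in> T v" "finite (T v)" if "v \<in> B" for v
  proof -
    show "T v \<subseteq> V" "v \<in> T v"
      using that B by (auto simp: T_def hanging_def)
    then show "finite (T v)"
      using finite_V finite_subset by blast
  qed
  have T_disj: "T u \<inter> T v = {}" if "u \<in> B" "v \<in> B" "u \<noteq> v" for u v
    using hanging_disjoint[OF max] that by (simp add: T_def)
  have T_closed: "nbrs z \<subseteq> T v" if "v \<in> B" "z \<in> T v" "z \<noteq> v" for v z
    using hanging_closed[OF max, of v z] that nbrs_subset[of z] unfolding T_def nbrs_def by blast
  have T_ne: "T v \<noteq> {v}" if v: "v \<in> B" for v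
  proof -
    \<comment> \<open>\<open>B\<close> has at most \<open>s\<close> vertices, so the degree bound
      forces a neighbour of \<open>v\<close> outside \<open>B\<close>.\<close>
    have "card B < card (nbrs v)"
      using card_parity_connected_le[OF B(2,1)] deg[of v] v B m by auto
    then have "\<not> nbrs v \<subseteq> B"
      using card_mono[OF B(4)] by (meson not_le)
    then obtain z where z: "z \<in> nbrs v" "z \<notin> B"
      by blast
    then have "z \<in> T v"
      using hanging_neighbour[of v B z V] v nbrs_subset unfolding T_def nbrs_def by blast
    then show ?thesis
      using z v by auto
  qed
  have T_large: "2 * m \<le> card (T v)" if v: "v \<in> B" for v
  proof -
    \<comment> \<open>Both \<open>z\<close> and the neighbour \<open>y\<close> chosen below avoid
      the root, since only then are their neighbourhoods known to stay inside
      \<open>T v\<close>.\<close>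
    obtain z where z: "z \<in> T v" "z \<noteq> v"
      using T_ne[OF v] T_V[OF v] by blast
    have "m \<le> card (nbrs z)"
      using z T_V v deg by blast
    then have "s < card (nbrs z - {v})"
      using m by (cases "v \<in> nbrs z") simp_all
    moreover have "nbrs z - {v} \<subseteq> V"
      using nbrs_subset[of z] by blast
    ultimately obtain y y' where y: "y \<in> nbrs z - {v}" "y' \<in> nbrs z - {v}" "linked y y'"
      using linked_pair_in[of "nbrs z - {v}"] by blast
    then have disj: "nbrs z \<inter> nbrs y = {}"
      using nbrs_disjoint_if_linked[of y y' z] by (auto simp: nbrs_def)
    have sub: "nbrs z \<subseteq> T v" "nbrs y \<subseteq> T v"
      using T_closed v z y by blast+
    have "y \<in> V"
      using y nbrs_subset by blast
    then have "2 * m \<le> card (nbrs z) + card (nbrs y)"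
      using deg[of y] \<open>m \<le> card (nbrs z)\<close> by simp
    also have "\<dots> = card (nbrs z \<union> nbrs y)"
      using disj by (simp add: card_Un_disjoint)
    also have "\<dots> \<le> card (T v)"
      using sub T_V[OF v] by (intro card_mono) auto
    finally show ?thesis .
  qed
  have card_UN: "card (\<Union>v\<in>B. T v) = (\<Sum>v\<in>B. card (T v))"
    using B T_V T_disj by (intro card_UN_disjoint) auto
  have UN: "(\<Union>v\<in>B. T v) \<subseteq> V"
    using T_V by blast
  then have sum_le: "(\<Sum>v\<in>B. card (T v)) \<le> card V"
    using card_mono[OF finite_V UN] card_UN by simp
  \<comment> \<open>With \<open>card V \<le> s * m\<close> and \<open>s = 2 * (r + 1)\<close> this
    bounds \<open>card B\<close> by \<open>r + 1\<close>. Uncolourability gives the converse bound,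
    and then every estimate is tight.\<close>
  have B_le: "card B * (2 * m) \<le> (\<Sum>v\<in>B. card (T v))"
    using sum_bounded_below[of B "2 * m" "\<lambda>v. card (T v)"] T_large by simp
  then have "card B * (2 * m) \<le> Suc r * (2 * m)"
    using sum_le n s by (simp add: mult.assoc mult.left_commute)
  then have "card B \<le> Suc r"
    using m unfolding mult_le_cancel2 by simp
  then have card_B: "card B = Suc r" and clique: "\<And>u v. u \<in> B \<Longrightarrow> v \<in> B \<Longrightarrow> u \<noteq> v \<Longrightarrow> E u v"
    using not_colourable_small B by blast+
  have lower: "s * m \<le> (\<Sum>v\<in>B. card (T v))"
    using B_le card_B s by (simp add: mult.assoc mult.left_commute)
  then show card_V: "card V = s * m"
    using sum_le n by linarith
  have "card (\<Union>v\<in>B. T v) = card V"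
    using card_UN sum_le lower card_V by linarith
  then have V_eq: "(\<Union>v\<in>B. T v) = V"
    using UN finite_V by (intro card_subset_eq) auto
  have T_card: "card (T v) = 2 * m" if v: "v \<in> B" for v
  proof (rule ccontr)
    assume "card (T v) \<noteq> 2 * m"
    then have "(\<Sum>v\<in>B. 2 * m) < (\<Sum>v\<in>B. card (T v))"
      using B T_large v by (intro sum_strict_mono_ex1) (auto intro!: bexI[of _ v] simp: le_neq_implies_less)
    then show False
      using card_B sum_le n s by (simp add: mult.assoc mult.left_commute)
  qed
  let ?P = "\<lambda>v X Y. T v = X \<union> Y \<and> X \<inter> Y = {} \<and> card X = m \<and> card Y = m \<and> v \<in> X \<and>
    (\<forall>z\<in>T v. \<forall>w\<in>T v. E z w \<longleftrightarrow> (z \<in> X \<and> w \<in> Y \<or> z \<in> Y \<and> w \<in> X))"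
  have "\<forall>v\<in>B. \<exists>X Y. ?P v X Y"
  proof
    fix v
    assume v: "v \<in> B"
    show "\<exists>X Y. ?P v X Y"
    proof (rule tight_piece_bipartite[OF T_V(3)[OF v] T_card[OF v] T_V(2)[OF v] T_ne[OF v] _ _ m])
      show "nbrs z \<subseteq> T v" if "z \<in> T v" "z \<noteq> v" for z
        using T_closed v that by blast
      show "m \<le> card (nbrs z)" if "z \<in> T v" for z
        using deg T_V(1)[OF v] that by blast
    qed
  qed
  from bchoice[OF this] obtain X where "\<forall>v\<in>B. \<exists>Y. ?P v (X v) Y" ..
  from bchoice[OF this] obtain Y where "\<forall>v\<in>B. ?P v (X v) (Y v)" ..
  then have XY: "\<And>v. v \<in> B \<Longrightarrow> T v = X v \<union> Y v" "\<And>v. v \<in> B \<Longrightarrow> X v \<inter> Y v = {}"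
      "\<And>v. v \<in> B \<Longrightarrow> card (X v) = m" "\<And>v. v \<in> B \<Longrightarrow> card (Y v) = m" "\<And>v. v \<in> B \<Longrightarrow> v \<in> X v"
      "\<And>v z w. v \<in> B \<Longrightarrow> z \<in> T v \<Longrightarrow> w \<in> T v \<Longrightarrow>
        E z w \<longleftrightarrow> (z \<in> X v \<and> w \<in> Y v \<or> z \<in> Y v \<and> w \<in> X v)"
    by simp_all
  have fin: "finite (X v)" "finite (Y v)" if "v \<in> B" for v
    using XY(1)[OF that] T_V(3)[OF that] by simp_all
  have "\<forall>v\<in>B. \<exists>g :: 'a \<Rightarrow> nat. bij_betw g (X v) {..<m} \<and> g v = 0"
    using bij_betw_with_base[OF fin(1) XY(3,5)] by blast
  from bchoice[OF this] obtain gX :: "'a \<Rightarrow> 'a \<Rightarrow> nat"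
    where gX: "\<And>v. v \<in> B \<Longrightarrow> bij_betw (gX v) (X v) {..<m}" "\<And>v. v \<in> B \<Longrightarrow> gX v v = 0"
    by auto
  have "\<forall>v\<in>B. \<exists>g :: 'a \<Rightarrow> nat. bij_betw g (Y v) {..<m}"
    using finite_same_card_bij[OF fin(2), of _ "{..<m}"] XY(4) by simp
  from bchoice[OF this] obtain gY :: "'a \<Rightarrow> 'a \<Rightarrow> nat"
    where gY: "\<And>v. v \<in> B \<Longrightarrow> bij_betw (gY v) (Y v) {..<m}"
    by auto
  obtain idx :: "'a \<Rightarrow> nat" where idx: "bij_betw idx B {..<Suc r}"
    using B card_B by (metis card_lessThan finite_lessThan finite_same_card_bij)
  define own where "own z = (SOME v. v \<in> B \<and> z \<in> T v)" for z
  have own: "own z \<in> B" "z \<in> T (own z)" if "z \<in> V" for z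
  proof -
    have "\<exists>v. v \<in> B \<and> z \<in> T v"
      using V_eq that by blast
    then show "own z \<in> B" "z \<in> T (own z)"
      unfolding own_def by (metis (mono_tags, lifting) someI_ex)+
  qed
  have own_eq: "own z = v" if "v \<in> B" "z \<in> T v" for v z
    using own[of z] T_disj T_V that by blast
  define side where "side z \<longleftrightarrow> z \<in> Y (own z)" for z
  define pos where "pos z = (if side z then gY (own z) z else gX (own z) z)" for z
  \<comment> \<open>The side \<open>False\<close> is the part \<open>X v\<close> containing the
    root, and the root has position 0, so roots go to the selected vertices.\<close>
  define f where "f z = (idx (own z), side z, pos z)" for z
  have inX: "z \<in> X (own z)" if "z \<in> V" "\<not> side z" for z
    using own[OF that(1)] XY(1) that by (auto simp: side_def)
  have inY: "z \<in> Y (own z)" if "side z" for z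
    using that by (simp add: side_def)
  have pos_less: "pos z < m" if "z \<in> V" for z
    using own(1)[OF that] gX(1) gY inX[OF that] inY
    by (auto simp: pos_def dest!: bij_betw_apply)
  have "inj_on f V"
  proof (rule inj_onI)
    fix z w
    assume zw: "z \<in> V" "w \<in> V" "f z = f w"
    then have o: "own z = own w"
      using own idx by (auto simp: f_def bij_betw_def dest: inj_onD)
    show "z = w"
    proof (cases "side z")
      case True
      then show ?thesis
        using zw o inY[of z] inY[of w] gY[OF own(1)[OF zw(1)]]
        by (auto simp: f_def pos_def bij_betw_def dest: inj_onD)
    next
      case False
      then show ?thesis
        using zw o inX[of z] inX[of w] gX(1)[OF own(1)[OF zw(1)]]
        by (auto simp: f_def pos_def bij_betw_def dest: inj_onD)
    qed
  qed
  moreover have "f ` V \<subseteq> {..<Suc r} \<times> UNIV \<times> {..<m}"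
    using own(1) idx pos_less by (auto simp: f_def bij_betw_def)
  \<comment> \<open>Equal cardinalities make the injection \<open>f\<close> onto.\<close>
  moreover have "card ({..<Suc r} \<times> (UNIV :: bool set) \<times> {..<m}) = card V"
    using card_V s by (simp add: card_cartesian_product)
  ultimately have "bij_betw f V ({..<Suc r} \<times> UNIV \<times> {..<m})"
    by (metis bij_betw_def card_image card_subset_eq finite_SigmaI finite_lessThan finite)
  moreover have "E a b \<longleftrightarrow> (f a, f b) \<in> parcs (bipartite_copies_clique (Suc r) m)"
    if ab: "a \<in> V" "b \<in> V" for a b
  proof -
    have base: "z = own z \<longleftrightarrow> \<not> side z \<and> pos z = 0" if z: "z \<in> V" for z
    proof
      assume "z = own z"
      then show "\<not> side z \<and> pos z = 0"
        using own(1)[OF z] XY(2,5)[of "own z"] gX(2)[of "own z"] by (auto simp: side_def pos_def)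
    next
      assume "\<not> side z \<and> pos z = 0"
      then have "z \<in> X (own z)" "gX (own z) z = gX (own z) (own z)"
        using inX[OF z] gX(2)[OF own(1)[OF z]] by (auto simp: pos_def)
      then show "z = own z"
        using gX(1)[OF own(1)[OF z]] XY(5)[OF own(1)[OF z]] by (auto simp: bij_betw_def dest: inj_onD)
    qed
    have mem: "(f a, f b) \<in> parcs (bipartite_copies_clique (Suc r) m) \<longleftrightarrow>
      own a = own b \<and> side a \<noteq> side b \<or> own a \<noteq> own b \<and> a = own a \<and> b = own b"
    proof -
      have "idx (own a) = idx (own b) \<longleftrightarrow> own a = own b"
        using idx own(1) ab by (metis bij_betw_def inj_on_eq_iff)
      moreover have "idx (own a) < Suc r" "idx (own b) < Suc r"
        using idx own(1) ab by (auto simp: bij_betw_def)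
      ultimately show ?thesis
        using base[OF ab(1)] base[OF ab(2)] pos_less ab
        by (simp add: bipartite_copies_clique_def f_def) blast
    qed
    show ?thesis
    proof (cases "own a = own b")
      case True
      have "E a b \<longleftrightarrow> (a \<in> X (own a) \<and> b \<in> Y (own a) \<or> a \<in> Y (own a) \<and> b \<in> X (own a))"
        by (rule XY(6)) (use own[OF ab(1)] own[OF ab(2)] True in simp_all)
      also have "\<dots> \<longleftrightarrow> side a \<noteq> side b"
        using inX[OF ab(1)] inX[OF ab(2)] XY(2)[OF own(1)[OF ab(1)]] True
        unfolding side_def by auto
      finally show ?thesis
        using mem True by simp
    next
      case False
      \<comment> \<open>All neighbours of a vertex that is not a root lie in its own piece, so an
        edge between two pieces joins their roots.\<close>
      have "a = own a" if "E a b"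
      proof (rule ccontr)
        assume "a \<noteq> own a"
        then have "b \<in> T (own a)"
          using T_closed[of "own a" a] own ab that by (auto simp: nbrs_def)
        then show False
          using own_eq own ab False by metis
      qed
      moreover have "b = own b" if "E a b"
      proof (rule ccontr)
        assume "b \<noteq> own b"
        then have "a \<in> T (own b)"
          using T_closed[of "own b" b] own ab sym[OF that] by (auto simp: nbrs_def)
        then show False
          using own_eq own ab False by metis
      qed
      moreover have "E a b" if "a = own a" "b = own b"
        using clique[of a b] own(1) ab False that by metis
      ultimately show ?thesis
        using mem False by blast
    qed
  qed
  ultimately show "\<exists>f. bij_betw f V ({..<Suc r} \<times> UNIV \<times> {..<m}) \<and>
    (\<forall>a\<in>V. \<forall>b\<in>V. E a b \<longleftrightarrow> (f a, f b) \<in> parcs (bipartite_copies_clique (Suc r) m))"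
    by blast
qed

end

section \<open>Passage to digraphs\<close>

text \<open>This is the second Bonferroni inequality: each new set meets the union of the earlier
  ones in at most \<open>card I * c\<close> elements.\<close>

lemma sum_card_le_card_UN:
  assumes "finite I" "\<And>x. x \<in> I \<Longrightarrow> finite (N x)"
    and "\<And>x y. x \<in> I \<Longrightarrow> y \<in> I \<Longrightarrow> x \<noteq> y \<Longrightarrow> card (N x \<inter> N y) \<le> c"
  shows "(\<Sum>x\<in>I. card (N x)) \<le> card (\<Union>x\<in>I. N x) + (card I choose 2) * c"
  using assms
proof (induction I rule: finite_induct)
  case (insert x I)
  let ?U = "\<Union>y\<in>I. N y"
  have "card (N x \<inter> ?U) = card (\<Union>y\<in>I. N x \<inter> N y)"
    by simp
  also have "\<dots> \<le> (\<Sum>y\<in>I. card (N x \<inter> N y))"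
    by (rule card_UN_le) (rule insert)
  also have "\<dots> \<le> card I * c"
    using insert.prems(2)[of x] insert.hyps sum_bounded_above[of I "\<lambda>y. card (N x \<inter> N y)" c]
    by force
  finally have "card (N x \<inter> ?U) \<le> card I * c" .
  moreover have "card (N x) + card ?U = card (N x \<union> ?U) + card (N x \<inter> ?U)"
    using insert by (intro card_Un_Int) auto
  moreover have "(\<Sum>y\<in>I. card (N y)) \<le> card ?U + (card I choose 2) * c"
    using insert by auto
  ultimately show ?case
    using insert.hyps by (simp add: numeral_2_eq_2 algebra_simps)
qed simp

text \<open>\<open>pre_digraph.cycle\<close> speaks of lists of arcs. Pairing each vertex with its
  cyclic successor turns a closed vertex list into such a list of the same length.\<close>

lemma cycle_of_vertex_list:
  assumes "distinct p" "p \<noteq> []" "successively (\<lambda>u v. (u, v) \<in> parcs G) p"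
    "(last p, hd p) \<in> parcs G" "hd p \<in> pverts G"
  shows "\<exists>q. pre_digraph.cycle (with_proj G) q \<and> length q = length p"
proof -
  have walk: "pcas x (zip (x # xs) (xs @ [y])) y \<and>
      set (zip (x # xs) (xs @ [y])) \<subseteq> parcs G \<and> pawalk_verts x (zip (x # xs) (xs @ [y])) = x # xs @ [y]"
    if "successively (\<lambda>u v. (u, v) \<in> parcs G) (x # xs @ [y])" for x xs y
    using that
  proof (induction xs arbitrary: x)
    case (Cons z xs)
    then show ?case
      using Cons.IH[of z] by simp
  qed simp
  obtain x xs where p: "p = x # xs"
    using assms by (cases p) auto
  have "successively (\<lambda>u v. (u, v) \<in> parcs G) (p @ [x])"
    using assms p by (subst successively_append_iff) simp
  then have "pre_digraph.cycle (with_proj G) (zip p (xs @ [x]))"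
    unfolding pre_digraph.cycle_def pre_digraph.awalk_def cas_with_proj_eq awalk_verts_with_proj_eq
    using walk[of x xs x] assms p by (intro exI[of _ x]) auto
  then show ?thesis
    using p by (intro exI[of _ "zip p (xs @ [x])"]) simp
qed

text \<open>Since arcs are pairs, \<open>map_prod f f\<close> serves as the arc map, and the
  equivalence in \<open>arcs\<close> makes it onto the arcs of \<open>H\<close>.\<close>

lemma digraph_iso_with_projI:
  assumes "pair_wf_digraph G" "pair_wf_digraph H" and f: "bij_betw f (pverts G) (pverts H)"
    and arcs: "\<And>a b. a \<in> pverts G \<Longrightarrow> b \<in> pverts G \<Longrightarrow>
      (a, b) \<in> parcs G \<longleftrightarrow> (f a, f b) \<in> parcs H"
  shows "digraph_iso (with_proj G) (with_proj H)"
proof -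
  interpret G: pair_wf_digraph G by fact
  interpret H: pair_wf_digraph H by fact
  let ?f = "\<lparr>iso_verts = f, iso_arcs = map_prod f f, iso_head = snd, iso_tail = fst\<rparr>"
  have inj: "inj_on f (pverts G)"
    using f by (simp add: bij_betw_def)
  have "inj_on (map_prod f f) (parcs G)"
  proof (rule inj_on_subset)
    show "inj_on (map_prod f f) (pverts G \<times> pverts G)"
      using inj inj by (rule map_prod_inj_on)
    show "parcs G \<subseteq> pverts G \<times> pverts G"
      by (auto dest: G.wellformed')
  qed
  then have "pre_digraph.digraph_isomorphism (with_proj G) ?f"
    using inj G.wf_digraph_axioms by (auto simp: pre_digraph.digraph_isomorphism_def)
  moreover have "parcs H = map_prod f f ` parcs G"
  proof
    show "parcs H \<subseteq> map_prod f f ` parcs G"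
    proof
      fix e
      assume e: "e \<in> parcs H"
      then have "fst e \<in> f ` pverts G" "snd e \<in> f ` pverts G"
        using f H.arc_fst_in_verts H.arc_snd_in_verts by (auto simp: bij_betw_def)
      then obtain a b where ab: "a \<in> pverts G" "b \<in> pverts G" "e = (f a, f b)"
        by (metis imageE prod.collapse)
      then show "e \<in> map_prod f f ` parcs G"
        using arcs[of a b] e by (auto intro!: image_eqI[of _ _ "(a, b)"])
    qed
    show "map_prod f f ` parcs G \<subseteq> parcs H"
      using arcs by (auto dest: G.wellformed')
  qed
  then have "with_proj H = app_iso ?f (with_proj G)"
    using f by (simp add: app_iso_def with_proj_def bij_betw_def)
  ultimately show ?thesis
    unfolding digraph_iso_def by blast
qed

lemma (in simple_graph) partite_if_colourable:
  assumes "colourable r V" "verts D = V" "\<And>u v. (u, v) \<in> arcs_ends D \<longleftrightarrow> E u v"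
  shows "partite r D"
proof -
  obtain c where c: "\<forall>v\<in>V. c v < r" "\<forall>u\<in>V. \<forall>v\<in>V. E u v \<longrightarrow> c u \<noteq> c v"
    using assms unfolding colourable_def by blast
  show ?thesis
    unfolding partite_def
  proof (intro exI conjI)
    show "verts D = (\<Union>i<r. {v \<in> V. c v = i})" "disjoint_family_on (\<lambda>i. {v \<in> V. c v = i}) {..<r}"
      using c(1) assms(2) by (auto simp: disjoint_family_on_def)
    show "\<forall>i<r. \<forall>u\<in>{v \<in> V. c v = i}. \<forall>v\<in>{v \<in> V. c v = i}. (u, v) \<notin> arcs_ends D"
    proof (intro allI impI ballI)
      fix i u v
      assume "u \<in> {v \<in> V. c v = i}" "v \<in> {v \<in> V. c v = i}"
      then have "u \<in> V" "v \<in> V" "c u = c v"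
        by simp_all
      then show "(u, v) \<notin> arcs_ends D"
        using c(2) assms(3) by metis
    qed
  qed
qed

text \<open>The left side is \<open>t\<close> times the number of pairs among
  \<open>2 * r + 3\<close> vertices, the error term when their neighbourhoods are counted. It fits
  because \<open>108 = 2 * 6 * 9\<close> and
  \<open>2 * r + 3 \<le> 9 * (r + 1) ^ (r - 3)\<close>.\<close>

lemma min_degree_large:
  fixes r k m n :: nat
  assumes "3 \<le> r" "108 * (r + 1) ^ r * k \<le> n" "n \<le> 2 * (r + 1) * m"
  shows "6 * (r + 1) * k * ((r + 1) * (2 * r + 3)) \<le> m"
proof -
  obtain q where r: "r = q + 3"
    using assms(1) by (metis add.commute le_iff_add)
  let ?R = "r + 1"
  have "q < 2 ^ q"
    by (rule less_exp)
  also have "\<dots> \<le> ?R ^ q"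
    by (intro power_mono) (simp_all add: r)
  finally have "2 * r + 3 \<le> 9 * ?R ^ q"
    using r by linarith
  then have "6 * ?R * k * (?R * (2 * r + 3)) \<le> 6 * ?R * k * (?R * (9 * ?R ^ q))"
    by (intro mult_left_mono) simp_all
  also have "\<dots> \<le> m"
  proof -
    have "?R ^ r = ?R * (?R * ?R * ?R ^ q)"
      by (simp add: r power_add power3_eq_cube)
    moreover have "2 * R * (6 * R * k * (R * (9 * P))) = 108 * (R * (R * R * P)) * k" for R P :: nat
      by algebra
    ultimately have "2 * ?R * (6 * ?R * k * (?R * (9 * ?R ^ q))) = 108 * ?R ^ r * k"
      by presburger
    also have "\<dots> \<le> 2 * ?R * m"
      using assms by linarith
    finally show ?thesis
      by (subst (asm) mult_le_cancel1) simp
  qed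
  finally show ?thesis .
qed

theorem theorem2p1:
  fixes r k n :: nat and G :: "'a pair_pre_digraph"
  assumes "r \<ge> 3" and "k \<ge> 3 * r + 4" and "n \<ge> 108 * (r + 1) ^ r * k"
    and "pair_graph G" and "card (pverts G) = n"
    and "\<not> (\<exists>p. pre_digraph.cycle (with_proj G) p \<and> length p = 2 * k + 1)"
    and "real (min_degree (with_proj G)) \<ge> real n / real (2 * r + 2)"
  shows "partite r (with_proj G) \<or>
    (2 * (r + 1) dvd n \<and>
     digraph_iso (with_proj G) (with_proj (bipartite_copies_clique (r + 1) (n div (2 * (r + 1))))))"
proof -
  interpret G: pair_graph G by fact
  define E where "E u v \<longleftrightarrow> (u, v) \<in> parcs G" for u v
  define s t m where "s = 2 * Suc r" and "t = 6 * (r + 1) * k" and "m = min_degree (with_proj G)"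
  interpret simple_graph "pverts G" E
    by unfold_locales
      (auto simp: E_def G.pair_finite_verts dest: G.arcs_symmetric G.no_loops' G.wellformed')
  have deg: "m \<le> card (nbrs v)" if "v \<in> pverts G" for v
  proof -
    have "out_arcs (with_proj G) v = Pair v ` nbrs v"
      by (auto simp: out_arcs_def nbrs_def E_def)
    then have "out_degree (with_proj G) v = card (nbrs v)"
      by (simp add: out_degree_def card_image inj_on_def)
    moreover have "m \<le> out_degree (with_proj G) v"
      unfolding m_def min_degree_def using that G.pair_finite_verts by (intro Min_le) auto
    ultimately show ?thesis
      by simp
  qed
  have "real n \<le> real m * real (2 * r + 2)"
    using assms(7) unfolding m_def by (subst (asm) pos_divide_le_eq) simp_all
  then have n: "n \<le> 2 * (r + 1) * m"
    unfolding of_nat_mult[symmetric] of_nat_le_iff by (simp add: algebra_simps)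
  have m: "t * ((r + 1) * (2 * r + 3)) \<le> m"
    using min_degree_large[OF assms(1,3) n] by (simp add: t_def)
  have t_eq: "t = s * (3 * k)"
    by (simp add: s_def t_def algebra_simps)
  have t: "s \<le> t" "0 < t"
    unfolding t_eq using assms(2) by (simp_all add: s_def)
  have codegree: "\<exists>x\<in>I. \<exists>y\<in>I. x \<noteq> y \<and> t \<le> card (nbrs x \<inter> nbrs y)"
    if I: "I \<subseteq> pverts G" "card I = Suc s" for I
  proof (rule ccontr)
    assume "\<not> ?thesis"
    then have "card (nbrs x \<inter> nbrs y) \<le> t - 1" if "x \<in> I" "y \<in> I" "x \<noteq> y" for x y
      using that t by (metis Suc_pred' less_Suc_eq_le not_le One_nat_def)
    \<comment> \<open>The left side is at least \<open>(2 * r + 3) * m\<close>, and the union has at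
      most \<open>n \<le> (2 * r + 2) * m\<close> vertices. One \<open>m\<close> is left over,
      bounded by the error term; having \<open>t - 1\<close> there instead of \<open>t\<close> makes
      the contradiction strict.\<close>
    then have "(\<Sum>x\<in>I. card (nbrs x)) \<le> card (\<Union>x\<in>I. nbrs x) + (card I choose 2) * (t - 1)"
      using I card_ge_0_finite[of I] by (intro sum_card_le_card_UN) auto
    moreover have "card (\<Union>x\<in>I. nbrs x) \<le> n"
      unfolding assms(5)[symmetric] using nbrs_subset by (intro card_mono G.pair_finite_verts) blast
    moreover have "card I * m \<le> (\<Sum>x\<in>I. card (nbrs x))"
      using sum_bounded_below[of I m "\<lambda>x. card (nbrs x)"] deg I by auto
    moreover have "card I choose 2 = (r + 1) * (2 * r + 3)"
      by (simp add: I s_def choose_two algebra_simps)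
    moreover have "card I * m = 2 * (r + 1) * m + m"
      by (simp add: I s_def)
    ultimately have "m \<le> (r + 1) * (2 * r + 3) * (t - 1)"
      using n by simp
    also have "\<dots> < (r + 1) * (2 * r + 3) * t"
      using t by simp
    finally show False
      using m by (simp add: mult.commute)
  qed
  have "s + 4 \<le> s * 3"
    using assms(1) by (simp add: s_def)
  then have "(s + 4) * k \<le> t"
    unfolding t_eq mult.assoc[symmetric] by (rule mult_le_mono1)
  then interpret odd_cycle_free_graph "pverts G" E s k t
  proof unfold_locales
    show "\<not> E (last p) (hd p)" if "distinct p" "length p = 2 * k + 1" "successively E p" for p
    proof
      assume "E (last p) (hd p)"
      moreover have "p \<noteq> []"
        using that(2) by auto
      ultimately show False
        using cycle_of_vertex_list[of p G] that assms(6) G.in_arcsD2[of "last p" "hd p"]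
        by (auto simp: E_def[abs_def])
    qed
  \<comment> \<open>The hypothesis \<open>k \<ge> 3 * r + 4\<close> supplies
    \<open>3 * s \<le> 2 * k\<close>, that is \<open>6 * r + 6 \<le> 2 * k\<close>.\<close>
  qed (use codegree assms(1,2) in \<open>auto simp: s_def\<close>)
  show ?thesis
  proof (cases "colourable r (pverts G)")
    case True
    then show ?thesis
      by (intro disjI1 partite_if_colourable) (simp_all add: E_def)
  next
    case False
    \<comment> \<open>From \<open>r \<ge> 3\<close> the two factors are at least 4 and 9. Together
      with \<open>s \<le> t\<close> and \<open>0 < t\<close> this leaves ample room for
      \<open>s + t + 1 < m\<close>.\<close>
    have "t * (4 * 9) \<le> t * ((r + 1) * (2 * r + 3))"
      using assms(1) by (intro mult_left_mono mult_mono) simp_all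
    then have "s + t + 1 < m"
      using m t by linarith
    then have *: "card (pverts G) = s * m"
        "\<exists>f. bij_betw f (pverts G) ({..<Suc r} \<times> UNIV \<times> {..<m}) \<and>
        (\<forall>a\<in>pverts G. \<forall>b\<in>pverts G. E a b \<longleftrightarrow> (f a, f b) \<in> parcs (bipartite_copies_clique (Suc r) m))"
      using colourable_or_extremal[of r m] deg n assms(1,5) False by (simp_all add: s_def)
    let ?H = "bipartite_copies_clique (Suc r) m"
    interpret H: pair_graph ?H
      by (rule pair_graph_bipartite_copies_clique)
    have "digraph_iso (with_proj G) (with_proj ?H)"
      using *(2) digraph_iso_with_projI[OF G.pair_wf_digraph H.pair_wf_digraph]
      by (auto simp: bipartite_copies_clique_def E_def)
    moreover have n_eq: "n = 2 * (r + 1) * m"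
      using *(1) assms(5) by (simp add: s_def)
    moreover have "n div (2 * (r + 1)) = m"
      unfolding n_eq by (rule nonzero_mult_div_cancel_left) simp
    ultimately show ?thesis
      by (metis Suc_eq_plus1 dvd_triv_left)
  qed
qed

end
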